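(* For all integers $k\ge 1$ and $n\ge 0$, $|\mathcal{M}_n(P^k_2)|=|\mathcal{M}_n(P^k_3)|=|\mathcal{M}_n(P^k_4)|=|\mathcal{M}_n(P^k_5)|$.
   Context: A matching of length $n$ is a partition of $\{1,2,\ldots,2n\}$ into blocks of size 2, called arcs. An arc is written $[a,b]$ with $a<b$; $a$ is its opener and $b$ its closer. A matching is a Stoimenow matching if it contains neither a pair of arcs $[i,\ell],[i+1,k]$ with $i+1<k<\ell$ (Type I) nor a pair of arcs $[k,j+1],[\ell,j]$ with $k<\ell<j$ (Type II). $\mathcal{M}_n$ is the set of Stoimenow matchings of length $n$ ($\mathcal{M}_0$ consists of the empty matching). A matching contains a pattern (another matching) if, after removing some (possibly no) arcs and relabelling the remaining endpoints increasingly by $1,2,\ldots$, one obtains that pattern; otherwise it avoids the pattern. $\mathcal{M}_n(P)$ is the set of matchings in $\mathcal{M}_n$ avoiding $P$. For $m\ge 1$, the $m$-chain is the matching of length $m$ whose arcs $[a_1,b_1],\ldots,[a_m,b_m]$ satisfy $a_1<a_2<b_1<a_3<b_2<a_4<b_3<\cdots<a_m<b_{m-1}<b_m$ (a single arc if $m=1$; $a_1<a_2<b_1<b_2$ if $m=2$); the $0$-chain is the empty matching. For matchings $M_1$ of length $p$ and $M_2$, $M_1\oplus M_2$ is the union of $M_1$ and the matching obtained from $M_2$ by increasing every element by $2p$. Let $A=\{[1,2]\}$ be the single-arc matching. The patterns (each with $k$ arcs) are: $P_2^k$ is the $k$-chain; $P_3^k=A\oplus((k-2)\text{-chain})\oplus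 A$ for $k\ge2$, and $P_3^1=A$; $P_4^k=A\oplus((k-1)\text{-chain})$; $P_5^k=((k-1)\text{-chain})\oplus A$. *)

theory Defs
  imports Main "HOL-Library.Disjoint_Sets"
begin

text \<open>An arc \<open>[a,b]\<close> with \<open>a < b\<close> is the two-element block \<open>{a, b}\<close>.\<close>

definition is_matching :: "nat \<Rightarrow> nat set set \<Rightarrow> bool" where
  "is_matching n M \<longleftrightarrow> partition_on {1..2 * n} M \<and> (\<forall>B\<in>M. card B = 2)"

definition type_I :: "nat set set \<Rightarrow> bool" where
  "type_I M \<longleftrightarrow> (\<exists>i k l. {i, l} \<in> M \<and> {i + 1, k} \<in> M \<and> i + 1 < k \<and> k < l)"

definition type_II :: "nat set set \<Rightarrow> bool" where
  "type_II M \<longleftrightarrow> (\<exists>j k l. {k, j + 1} \<in> M \<and> {l, j} \<in> M \<and> k < l \<and> l < j)"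

definition stoimenow_matchings :: "nat \<Rightarrow> nat set set set" where
  "stoimenow_matchings n = {M. is_matching n M \<and> \<not> type_I M \<and> \<not> type_II M}"

text \<open>The endpoint \<open>x\<close> receives as new label its rank among all endpoints of \<open>S\<close>.\<close>

definition relabel :: "nat set set \<Rightarrow> nat set set" where
  "relabel S = (\<lambda>B. (\<lambda>x. card {y \<in> \<Union>S. y \<le> x}) ` B) ` S"

definition contains_pattern :: "nat set set \<Rightarrow> nat set set \<Rightarrow> bool" where
  "contains_pattern M P \<longleftrightarrow> (\<exists>S\<subseteq>M. relabel S = P)"

definition avoiders :: "nat \<Rightarrow> nat set set \<Rightarrow> nat set set set" where
  "avoiders n P = {M \<in> stoimenow_matchings n. \<not> contains_pattern M P}"

text \<open>The conditions below are the consecutive inequalities in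
  \<open>a 1 < a 2 < b 1 < a 3 < b 2 < \<dots> < a m < b (m - 1) < b m\<close>:
  after \<open>a 1 < a 2\<close> the steps \<open>a (i + 1) < b i\<close> and \<open>b i < a (i + 2)\<close> alternate.
  For \<open>m = 1\<close> only \<open>a 1 < b 1\<close> remains, and for \<open>m = 0\<close> there is no condition.\<close>

definition is_chain :: "nat \<Rightarrow> nat set set \<Rightarrow> bool" where
  "is_chain m C \<longleftrightarrow> is_matching m C \<and>
    (\<exists>a b :: nat \<Rightarrow> nat. C = {{a i, b i} | i. 1 \<le> i \<and> i \<le> m} \<and>
       (m = 1 \<longrightarrow> a 1 < b 1) \<and>
       (2 \<le> m \<longrightarrow> a 1 < a 2 \<and> b (m - 1) < b m) \<and>
       (\<forall>i. 1 \<le> i \<and> i + 1 \<le> m \<longrightarrow> a (i + 1) < b i) \<and>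
       (\<forall>i. 1 \<le> i \<and> i + 2 \<le> m \<longrightarrow> b i < a (i + 2)))"

definition chain_matching :: "nat \<Rightarrow> nat set set" where
  "chain_matching m = (THE C. is_chain m C)"

text \<open>The length of a matching is its number of arcs, i.e. \<open>card\<close>.\<close>

definition msum :: "nat set set \<Rightarrow> nat set set \<Rightarrow> nat set set" where
  "msum M1 M2 = M1 \<union> (\<lambda>B. (\<lambda>x. x + 2 * card M1) ` B) ` M2"

definition single_arc :: "nat set set" where
  "single_arc = {{1, 2}}"

definition P2 :: "nat \<Rightarrow> nat set set" where
  "P2 k = chain_matching k"

definition P3 :: "nat \<Rightarrow> nat set set" where
  "P3 k = (if k = 1 then single_arc
           else msum (msum single_arc (chain_matching (k - 2))) single_arc)"

definition P4 :: "nat \<Rightarrow> nat set set" where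
  "P4 k = msum single_arc (chain_matching (k - 1))"

definition P5 :: "nat \<Rightarrow> nat set set" where
  "P5 k = msum (chain_matching (k - 1)) single_arc"

text \<open>The description defining \<^const>\<open>chain_matching\<close> is proper: the inequalities determine
  all endpoints, namely as \<open>chain_opener\<close> and \<open>chain_closer m\<close> below.\<close>

definition chain_opener :: "nat \<Rightarrow> nat" where
  "chain_opener i = (if i = 1 then 1 else 2 * i - 2)"

definition chain_closer :: "nat \<Rightarrow> nat \<Rightarrow> nat" where
  "chain_closer m i = (if i = m then 2 * m else 2 * i + 1)"

lemma strict_mono_on_interval_id:
  fixes s :: "nat \<Rightarrow> nat"
  assumes step: "\<And>j. 1 \<le> j \<Longrightarrow> j < N \<Longrightarrow> s j < s (j + 1)"
    and range: "\<And>j. 1 \<le> j \<Longrightarrow> j \<le> N \<Longrightarrow> 1 \<le> s j \<and> s j \<le> N"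
    and j: "1 \<le> j" "j \<le> N"
  shows "s j = j"
proof -
  have lo: "j \<le> s j" using j
  proof (induction j rule: nat_induct_at_least)
    case base then show ?case using range[of 1] by simp
  next
    case (Suc n) then show ?case using step[of n] by simp
  qed
  have "s (N - d) \<le> N - d" if "d < N" for d using that
  proof (induction d)
    case 0 then show ?case using range[of N] by simp
  next
    case (Suc d)
    then have "s (N - Suc d) < s (N - d)"
      using step[of "N - Suc d"] by (simp add: Suc_diff_Suc)
    then show ?case using Suc by simp
  qed
  from this[of "N - j"] j have "s j \<le> j" by simp
  with lo show ?thesis by simp
qed

lemma is_chain_unique:
  assumes "is_chain m C"
  shows "C = {{chain_opener i, chain_closer m i} | i. 1 \<le> i \<and> i \<le> m}"
proof -
  obtain a b :: "nat \<Rightarrow> nat" where C: "C = {{a i, b i} | i. 1 \<le> i \<and> i \<le> m}"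
    and m1: "m = 1 \<longrightarrow> a 1 < b 1"
    and m2: "2 \<le> m \<longrightarrow> a 1 < a 2 \<and> b (m - 1) < b m"
    and ab: "\<And>i. 1 \<le> i \<Longrightarrow> i + 1 \<le> m \<Longrightarrow> a (i + 1) < b i"
    and ba: "\<And>i. 1 \<le> i \<Longrightarrow> i + 2 \<le> m \<Longrightarrow> b i < a (i + 2)"
    and mt: "is_matching m C"
    using assms unfolding is_chain_def by blast
  have U: "\<Union>C = {1..2 * m}"
    using mt unfolding is_matching_def partition_on_def by blast
  have rng: "1 \<le> a i \<and> a i \<le> 2 * m \<and> 1 \<le> b i \<and> b i \<le> 2 * m" if "1 \<le> i" "i \<le> m" for i
  proof -
    have "{a i, b i} \<subseteq> \<Union>C" using that C by blast
    then show ?thesis unfolding U by simp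
  qed
  define s where "s j = (if j = 1 then a 1 else if j = 2 * m then b m
      else if even j then a (j div 2 + 1) else b (j div 2))" for j
  have step: "s j < s (j + 1)" if "1 \<le> j" "j < 2 * m" for j
  proof (cases "even j")
    case True
    then obtain i where i: "j = 2 * i" by (elim evenE)
    with that show ?thesis using ab[of i] by (auto simp: s_def)
  next
    case False
    then obtain i where i: "j = 2 * i + 1" by (elim oddE)
    show ?thesis
    proof (cases "i = 0")
      case True
      then show ?thesis using i that m1 m2
        by (cases "m = 1") (auto simp: s_def numeral_2_eq_2)
    next
      case i0: False
      show ?thesis
      proof (cases "i + 1 = m")
        case True
        then show ?thesis using i i0 m2 by (auto simp: s_def)
      next
        case False
        then show ?thesis using i i0 that ba[of i] by (auto simp: s_def)
      qed
    qed
  qed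
  have sr: "1 \<le> s j \<and> s j \<le> 2 * m" if "1 \<le> j" "j \<le> 2 * m" for j
    using that rng[of 1] rng[of m] rng[of "j div 2 + 1"] rng[of "j div 2"]
    by (cases "j = 1"; cases "j = 2 * m"; cases "even j") (auto simp: s_def elim!: evenE oddE)
  have sid: "s j = j" if "1 \<le> j" "j \<le> 2 * m" for j
    by (rule strict_mono_on_interval_id[of "2 * m"]) (use step sr that in auto)
  have A: "a i = chain_opener i" if "1 \<le> i" "i \<le> m" for i
  proof (cases "i = 1")
    case True
    then show ?thesis using sid[of 1] that by (simp add: s_def chain_opener_def)
  next
    case False
    define l where "l = i - 1"
    with that False have l: "i = l + 1" "1 \<le> l" by auto
    then show ?thesis using sid[of "2 * l"] that
      by (simp add: s_def chain_opener_def)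
  qed
  have B: "b i = chain_closer m i" if "1 \<le> i" "i \<le> m" for i
  proof (cases "i = m")
    case True
    then show ?thesis using sid[of "2 * m"] that by (simp add: s_def chain_closer_def)
  next
    case False
    with that have "2 * i + 1 \<noteq> 2 * m" by presburger
    then show ?thesis using sid[of "2 * i + 1"] that False
      by (simp add: s_def chain_closer_def)
  qed
  show ?thesis unfolding C by (simp add: A B cong: rev_conj_cong)
qed

lemma is_chain_exists:
  "is_chain m {{chain_opener i, chain_closer m i} | i. 1 \<le> i \<and> i \<le> m}" (is "is_chain m ?C")
proof -
  have lt: "chain_opener i < chain_closer m i" if "1 \<le> i" "i \<le> m" for i
    using that by (auto simp: chain_opener_def chain_closer_def)
  have sub: "\<Union>?C \<subseteq> {1..2 * m}"
    by (auto simp: chain_opener_def chain_closer_def)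
  have sup: "x \<in> \<Union>?C" if "x \<in> {1..2 * m}" for x
  proof -
    have m: "1 \<le> m" using that by auto
    have *: "x \<in> \<Union>?C" if "1 \<le> i" "i \<le> m" "x = chain_opener i \<or> x = chain_closer m i" for i
      using that by blast
    consider "x = 1" | "x = 2 * m" | i where "x = 2 * i" "1 \<le> i" "i < m"
      | i where "x = 2 * i + 1" "1 \<le> i" "i < m"
    proof (cases "even x")
      case True
      then obtain i where "x = 2 * i" by (elim evenE)
      then show thesis using that \<open>x \<in> {1..2 * m}\<close> by (cases "i = m") auto
    next
      case False
      then obtain i where "x = 2 * i + 1" by (elim oddE)
      then show thesis using that \<open>x \<in> {1..2 * m}\<close> by (cases "i = 0") auto
    qed
    then show ?thesis
    proof cases
      case 1 then show ?thesis using *[of 1] m by (simp add: chain_opener_def)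
    next
      case 2 then show ?thesis using *[of m] m by (simp add: chain_closer_def)
    next
      case (3 i) then show ?thesis using *[of "i + 1"] by (simp add: chain_opener_def)
    next
      case (4 i) then show ?thesis using *[of i] by (simp add: chain_closer_def)
    qed
  qed
  have opcl: "chain_opener i \<noteq> chain_closer m j"
    if "1 \<le> i" "i \<le> m" "1 \<le> j" "j \<le> m" for i j
  proof (cases "i = 1 \<or> j = m")
    case True
    then show ?thesis using that by (auto simp: chain_opener_def chain_closer_def)
  next
    case False
    then have "chain_opener i = 2 * (i - 1)" "chain_closer m j = 2 * j + 1"
      using that by (auto simp: chain_opener_def chain_closer_def)
    then show ?thesis by presburger
  qed
  have opop: "i = j" if "chain_opener i = chain_opener j" "1 \<le> i" "1 \<le> j" for i j
  proof -
    have odd_iff: "odd (chain_opener l) \<longleftrightarrow> l = 1" if "1 \<le> l" for l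
      by (simp add: chain_opener_def)
    show ?thesis
    proof (cases "i = 1 \<or> j = 1")
      case True
      then show ?thesis using odd_iff[of i] odd_iff[of j] that by metis
    next
      case False
      then show ?thesis using that by (simp add: chain_opener_def)
    qed
  qed
  have clcl: "i = j" if "chain_closer m i = chain_closer m j" for i j
    using that unfolding chain_closer_def by (auto split: if_splits)
  have disj: "disjoint ?C"
  proof (rule disjointI)
    fix X Y assume "X \<in> ?C" "Y \<in> ?C" "X \<noteq> Y"
    then obtain i j where ij: "X = {chain_opener i, chain_closer m i}" "1 \<le> i" "i \<le> m"
        "Y = {chain_opener j, chain_closer m j}" "1 \<le> j" "j \<le> m" by blast
    then have "i \<noteq> j" using \<open>X \<noteq> Y\<close> by blast
    then show "X \<inter> Y = {}"
      using ij opcl[of i j] opcl[of j i] opop[of i j] clcl[of i j] by auto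
  qed
  have "is_matching m ?C"
    unfolding is_matching_def partition_on_def
  proof (intro conjI ballI)
    show "\<Union>?C = {1..2 * m}" using sub sup by blast
    show "disjoint ?C" by (rule disj)
    show "{} \<notin> ?C" by blast
    fix B assume "B \<in> ?C"
    then obtain i where "B = {chain_opener i, chain_closer m i}" "1 \<le> i" "i \<le> m" by blast
    then show "card B = 2" using lt[of i] by simp
  qed
  moreover have "m = 1 \<longrightarrow> chain_opener 1 < chain_closer m 1"
    "2 \<le> m \<longrightarrow> chain_opener 1 < chain_opener 2 \<and> chain_closer m (m - 1) < chain_closer m m"
    "\<forall>i. 1 \<le> i \<and> i + 1 \<le> m \<longrightarrow> chain_opener (i + 1) < chain_closer m i"
    "\<forall>i. 1 \<le> i \<and> i + 2 \<le> m \<longrightarrow> chain_closer m i < chain_opener (i + 2)"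
    by (auto simp: chain_opener_def chain_closer_def)
  ultimately show ?thesis unfolding is_chain_def by blast
qed

lemma chain_matching_eq:
  "chain_matching m = {{chain_opener i, chain_closer m i} | i. 1 \<le> i \<and> i \<le> m}"
  unfolding chain_matching_def
  by (rule the_equality) (simp_all only: is_chain_exists is_chain_unique)

lemma is_chain_chain_matching: "is_chain m (chain_matching m)"
  unfolding chain_matching_eq by (rule is_chain_exists)

lemma finite_stoimenow_matchings: "finite (stoimenow_matchings n)"
proof (rule finite_subset)
  show "stoimenow_matchings n \<subseteq> Pow (Pow {1..2 * n})"
    unfolding stoimenow_matchings_def is_matching_def partition_on_def by blast
qed simp

lemma finite_avoiders: "finite (avoiders n P)"
  unfolding avoiders_def by (simp add: finite_stoimenow_matchings)

end

theory Submission
  imports Defs "HOL-Library.Infinite_Set"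
begin

text \<open>Number the closers of a matching from left to right and let \<open>v p\<close> be the number of closers
  preceding the opener of the \<open>p\<close>-th closer. A Stoimenow matching is determined by \<open>v\<close>; the possible
  sequences are those with \<open>v p < p\<close> such that every \<open>p < n\<close> with \<open>v (p + 1) < v p\<close> is a value of \<open>v\<close>.
  If \<open>0 < v p\<close>, a chain starts at the arc \<open>p\<close> iff \<open>v p\<close> does not exceed a number \<open>peak p\<close>
  depending only on \<open>v\<close>.
  An additional arc left of the chain exists iff \<open>0 < v p\<close>, so \<open>P4\<close> is avoided iff always \<open>v p = 0\<close> or
  \<open>peak p < v p\<close>. A chain can be extended to the left by one arc iff its first two openers
  are separated by a closer, so \<open>P2\<close> is avoided iff always \<open>peak p \<le> v p\<close>. Replacing the values
  \<open>v p = peak p\<close> by \<open>0\<close> leaves all peaks unchanged and is a bijection between the two kinds of sequences.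
  If the chains are required to end before the last opener, the same bijection
  relates \<open>P5\<close> to \<open>P3\<close>. Finally \<open>P4\<close> and \<open>P5\<close> are mirror images.\<close>

section \<open>Sequences and their peaks\<close>

text \<open>The condition \<open>v p < p\<close> puts an opener before its closer. Closers
  \<open>p\<close> and \<open>p + 1\<close> are adjacent positions exactly when \<open>p\<close> is
  no value of \<open>v\<close>, so excluding type II forbids a descent there; excluding type I fixes
  the order of openers inside a gap. A threshold \<open>peak\<close> exists because the number
  \<open>x\<close> of closers before the first opener enters the chain condition only as
  \<open>x \<le> v q\<close> for the second arc \<open>q\<close>: admissible \<open>x\<close> are
  closed downwards. The obstacle is that peaks, the value set and the bound on the last closer all
  depend on the sequence being changed. One fact protects them at positive level: a positive entry
  equal to its peak recurs further right, so the last occurrence of a value is never lowered. At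
  level \<open>0\<close> the peak is \<open>p - 1\<close> or \<open>0\<close> and need not be a
  value, which is why the case \<open>t = 0\<close> is argued separately.\<close>

definition fishburn_seqs :: "nat \<Rightarrow> (nat \<Rightarrow> nat) set" where
  "fishburn_seqs n = {v. (\<forall>p. v p \<le> p - 1) \<and> (\<forall>p>n. v p = 0) \<and>
     (\<forall>p. 1 \<le> p \<and> p < n \<and> v (p + 1) < v p \<longrightarrow> p \<in> v ` {..n})}"

text \<open>For chains of \<open>t + 1\<close> arcs, \<open>peak n N v t p\<close> is the largest \<open>x \<ge> 1\<close> such that an
  arc with \<open>x\<close> closers before its opener and with closer index \<open>p\<close> would start one whose last closer
  has index at most \<open>N\<close>, and \<open>0\<close> if there is no such \<open>x\<close>.\<close>

fun peak :: "nat \<Rightarrow> nat \<Rightarrow> (nat \<Rightarrow> nat) \<Rightarrow> nat \<Rightarrow> nat \<Rightarrow> nat" where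
  "peak n N v 0 p = (if p \<le> N then p - 1 else 0)"
| "peak n N v (Suc t) p = Max (insert 0 (v ` {q. q \<le> n \<and> v q < p \<and> p \<le> peak n N v t q}))"

declare peak.simps(2) [simp del]

lemma finite_peak_set: "finite (v ` {q::nat. q \<le> n \<and> Q q})"
  by simp

lemma peak_Suc_le_iff:
  "peak n N v (Suc t) p \<le> x \<longleftrightarrow> (\<forall>q\<le>n. v q < p \<and> p \<le> peak n N v t q \<longrightarrow> v q \<le> x)"
  by (auto simp: peak.simps(2) finite_peak_set)

lemma le_peak_Suc_iff:
  assumes "1 \<le> x"
  shows "x \<le> peak n N v (Suc t) p \<longleftrightarrow> (\<exists>q\<le>n. x \<le> v q \<and> v q < p \<and> p \<le> peak n N v t q)"
  using assms by (auto simp: peak.simps(2) Max_ge_iff finite_peak_set)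

lemma peak_le: "peak n N v t p \<le> p - 1"
proof (cases t)
  case (Suc t')
  then show ?thesis unfolding Suc peak_Suc_le_iff by auto
qed simp

text \<open>The bound \<open>p < q\<close> comes from \<open>peak_le\<close> at \<open>q\<close>: a
  positive peak of positive level is an entry of \<open>v\<close> strictly to the right. Every
  rightmost-index argument rests on this.\<close>

lemma peak_Suc_attained:
  assumes "0 < peak n N v (Suc t) p"
  obtains q where "q \<le> n" "v q = peak n N v (Suc t) p" "v q < p" "p \<le> peak n N v t q" "p < q"
proof -
  have "peak n N v (Suc t) p \<in> insert 0 (v ` {q. q \<le> n \<and> v q < p \<and> p \<le> peak n N v t q})"
    unfolding peak.simps(2) by (rule Max_in) auto
  then obtain q where q: "q \<le> n" "v q = peak n N v (Suc t) p" "v q < p" "p \<le> peak n N v t q"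
    using assms by auto
  moreover have "p < q" using q peak_le[of n N v t q] by linarith
  ultimately show ?thesis using that by blast
qed

text \<open>Deleting the last arc of a chain leaves a chain whose last closer is further left, so
  the bound \<open>N\<close> still holds.\<close>

lemma peak_Suc_le: "peak n N v (Suc t) p \<le> peak n N v t p"
proof (induction t arbitrary: p)
  case 0
  have "p \<le> N" if "p \<le> peak n N v 0 q" "v q < p" for q
    using that by (auto split: if_splits)
  then show ?case unfolding peak_Suc_le_iff by (auto split: if_splits)
next
  case (Suc t)
  show ?case
    unfolding peak_Suc_le_iff[of n N v "Suc t"]
  proof (intro allI impI, elim conjE)
    fix q assume q: "q \<le> n" "v q < p" "p \<le> peak n N v (Suc t) q"
    then have "p \<le> peak n N v t q" using Suc[of q] by linarith
    then show "v q \<le> peak n N v (Suc t) p"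
      using peak_Suc_le_iff[of n N v t p "peak n N v (Suc t) p"] q by blast
  qed
qed

lemma peak_antimono: "s \<le> t \<Longrightarrow> peak n N v t p \<le> peak n N v s p"
  proof (induction t rule: dec_induct)
  case (step t)
  then show ?case using peak_Suc_le[of n N v t p] by linarith
qed simp

text \<open>Keeps \<open>raise\<close> from writing positive entries beyond
  \<open>n\<close>.\<close>

lemma peak_outside:
  assumes "N \<le> n" "n < p"
  shows "peak n N v t p = 0"
proof (cases t)
  case 0
  then show ?thesis using assms by simp
next
  case (Suc t')
  show ?thesis
  proof (rule ccontr)
    assume "peak n N v t p \<noteq> 0"
    then obtain q where "q \<le> n" "p < q"
      using peak_Suc_attained[of n N v t' p] unfolding Suc by auto
    then show False using assms by simp
  qed
qed

text \<open>The witness is the rightmost place where the value counts: if it equalled its own peak,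
  the value would be attained again further to the right.\<close>

lemma peak_last_place:
  assumes "q \<le> n" "0 < v q" "1 \<le> p" "s \<le> t" "p \<le> peak n N v s q"
  obtains q' where "q' \<le> n" "v q' = v q" "p \<le> peak n N v s q'" "v q' \<noteq> peak n N v (Suc t) q'"
proof -
  define S where "S = {r. r \<le> n \<and> v r = v q \<and> p \<le> peak n N v s r}"
  have S: "finite S" "q \<in> S" using assms by (auto simp: S_def)
  have M: "Max S \<in> S" using S by (intro Max_in) auto
  have "v (Max S) \<noteq> peak n N v (Suc t) (Max S)"
  proof
    assume eq: "v (Max S) = peak n N v (Suc t) (Max S)"
    then obtain r where r: "r \<le> n" "v r = v (Max S)" "Max S \<le> peak n N v t r" "Max S < r"
      using peak_Suc_attained[of n N v t "Max S"] M assms(2) unfolding S_def by auto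
    have "p \<le> Max S" using M peak_le[of n N v s "Max S"] unfolding S_def by auto
    also have "\<dots> \<le> peak n N v s r" using r peak_antimono[OF assms(4)] le_trans by blast
    finally have "r \<in> S" using r M unfolding S_def by auto
    then show False using r S by (simp add: leD)
  qed
  then show ?thesis using that M unfolding S_def by blast
qed

section \<open>Exchanging the values \<open>0\<close> and \<open>peak\<close>\<close>

definition lower :: "nat \<Rightarrow> nat \<Rightarrow> nat \<Rightarrow> (nat \<Rightarrow> nat) \<Rightarrow> nat \<Rightarrow> nat" where
  "lower n N t v p = (if v p = peak n N v t p then 0 else v p)"

definition raise :: "nat \<Rightarrow> nat \<Rightarrow> nat \<Rightarrow> (nat \<Rightarrow> nat) \<Rightarrow> nat \<Rightarrow> nat" where
  "raise n N t v p = (if v p = 0 then peak n N v t p else v p)"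

lemma le_antisym_pos:
  fixes a b :: nat
  assumes "\<And>x. 1 \<le> x \<Longrightarrow> x \<le> a \<longleftrightarrow> x \<le> b"
  shows "a = b"
  using assms[of a] assms[of b] by (cases "a = 0"; cases "b = 0") auto

text \<open>Induction on the level. Entries that stay positive are unchanged, so lowering creates no
  witnesses; a witness that is itself lowered is replaced by the unlowered one with the same value
  from \<open>peak_last_place\<close>.\<close>

lemma peak_lower: "s \<le> t \<Longrightarrow> peak n N (lower n N t v) s p = peak n N v s p"
proof (induction s arbitrary: p)
  case (Suc s)
  then obtain t' where t: "t = Suc t'" "s \<le> t'" by (cases t) auto
  have IH: "\<And>q. peak n N (lower n N t v) s q = peak n N v s q" using Suc by simp
  show ?case
  proof (rule le_antisym_pos)
    fix x :: nat assume x: "1 \<le> x"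
    show "x \<le> peak n N (lower n N t v) (Suc s) p \<longleftrightarrow> x \<le> peak n N v (Suc s) p"
      unfolding le_peak_Suc_iff[OF x] IH
    proof
      assume "\<exists>q\<le>n. x \<le> lower n N t v q \<and> lower n N t v q < p \<and> p \<le> peak n N v s q"
      then show "\<exists>q\<le>n. x \<le> v q \<and> v q < p \<and> p \<le> peak n N v s q"
        using x by (auto simp: lower_def split: if_splits)
    next
      assume "\<exists>q\<le>n. x \<le> v q \<and> v q < p \<and> p \<le> peak n N v s q"
      then obtain q where q: "q \<le> n" "x \<le> v q" "v q < p" "p \<le> peak n N v s q" by blast
      then obtain q' where "q' \<le> n" "v q' = v q" "p \<le> peak n N v s q'" "v q' \<noteq> peak n N v t q'"
        using peak_last_place[of q n v p s t' N] x t by auto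
      then show "\<exists>q\<le>n. x \<le> lower n N t v q \<and> lower n N t v q < p \<and> p \<le> peak n N v s q"
        using q by (intro exI[of _ q']) (auto simp: lower_def)
    qed
  qed
qed simp

text \<open>Raising destroys no witness with a positive value. A raised entry \<open>q\<close> used
  as a witness carries a value that \<open>v\<close> already attains at some \<open>r\<close> to its
  right with \<open>q \<le> peak n N v t' r\<close>; since \<open>p \<le> q\<close>, this
  \<open>r\<close> serves instead.\<close>

lemma peak_raise: "s \<le> t \<Longrightarrow> peak n N (raise n N t v) s p = peak n N v s p"
proof (induction s arbitrary: p)
  case (Suc s)
  then obtain t' where t: "t = Suc t'" "s \<le> t'" by (cases t) auto
  have IH: "\<And>q. peak n N (raise n N t v) s q = peak n N v s q" using Suc by simp
  show ?case
  proof (rule le_antisym_pos)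
    fix x :: nat assume x: "1 \<le> x"
    show "x \<le> peak n N (raise n N t v) (Suc s) p \<longleftrightarrow> x \<le> peak n N v (Suc s) p"
      unfolding le_peak_Suc_iff[OF x] IH
    proof
      assume "\<exists>q\<le>n. x \<le> raise n N t v q \<and> raise n N t v q < p \<and> p \<le> peak n N v s q"
      then obtain q where q: "q \<le> n" "x \<le> raise n N t v q" "raise n N t v q < p" "p \<le> peak n N v s q"
        by blast
      show "\<exists>q\<le>n. x \<le> v q \<and> v q < p \<and> p \<le> peak n N v s q"
      proof (cases "v q = 0")
        case True
        then have "raise n N t v q = peak n N v (Suc t') q" by (simp add: raise_def t)
        then obtain r where r: "r \<le> n" "v r = raise n N t v q" "q \<le> peak n N v t' r"
          using peak_Suc_attained[of n N v t' q] x q by auto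
        have "p \<le> q" using q peak_le[of n N v s q] by linarith
        also have "q \<le> peak n N v s r" using r peak_antimono[OF t(2)] le_trans by blast
        finally show ?thesis using r q by (intro exI[of _ r]) auto
      next
        case False
        then show ?thesis using q by (auto simp: raise_def)
      qed
    next
      assume "\<exists>q\<le>n. x \<le> v q \<and> v q < p \<and> p \<le> peak n N v s q"
      then obtain q where "q \<le> n" "x \<le> v q" "v q < p" "p \<le> peak n N v s q" by blast
      then show "\<exists>q\<le>n. x \<le> raise n N t v q \<and> raise n N t v q < p \<and> p \<le> peak n N v s q"
        using x by (intro exI[of _ q]) (auto simp: raise_def)
    qed
  qed
qed simp

text \<open>The bound \<open>N\<close> is a function of the sequence so that chains without a
  restriction (\<open>n\<close>) and chains ending before the last opener (the largest value of
  \<open>v\<close>) are treated at once.\<close>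

definition low_seqs :: "nat \<Rightarrow> ((nat \<Rightarrow> nat) \<Rightarrow> nat) \<Rightarrow> nat \<Rightarrow> (nat \<Rightarrow> nat) set" where
  "low_seqs n N t = {v \<in> fishburn_seqs n. \<forall>p\<le>n. v p = 0 \<or> peak n (N v) v t p < v p}"

definition high_seqs :: "nat \<Rightarrow> ((nat \<Rightarrow> nat) \<Rightarrow> nat) \<Rightarrow> nat \<Rightarrow> (nat \<Rightarrow> nat) set" where
  "high_seqs n N t = {v \<in> fishburn_seqs n. \<forall>p\<le>n. peak n (N v) v t p \<le> v p}"

text \<open>In a sequence of the high kind a zero entry has peak zero, so the zeros with positive
  peak that \<open>raise\<close> meets are exactly those made by \<open>lower\<close>.\<close>

lemma raise_lower:
  assumes "\<forall>p\<le>n. peak n N v t p \<le> v p" "N \<le> n" "\<forall>p>n. v p = 0"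
  shows "raise n N t (lower n N t v) = v"
proof
  fix p
  have "peak n N v t p \<le> v p" using assms peak_outside[of N n p v t] by (cases "p \<le> n") auto
  then show "raise n N t (lower n N t v) p = v p"
    by (simp add: raise_def peak_lower) (auto simp: lower_def)
qed

text \<open>In a sequence of the low kind no positive entry equals its peak, so \<open>lower\<close>
  resets exactly the entries filled by \<open>raise\<close>.\<close>

lemma lower_raise:
  assumes "\<forall>p\<le>n. v p = 0 \<or> peak n N v t p < v p" "N \<le> n" "\<forall>p>n. v p = 0"
  shows "lower n N t (raise n N t v) = v"
proof
  fix p
  have "v p = 0 \<or> peak n N v t p < v p" using assms by (cases "p \<le> n") auto
  then show "lower n N t (raise n N t v) p = v p"
    by (simp add: lower_def peak_raise) (auto simp: raise_def)
qed

text \<open>The rightmost occurrence of a positive value is not lowered, since equality with its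
  peak would give a later occurrence. The value \<open>0\<close> is always present through the
  phantom index \<open>0\<close>.\<close>

lemma range_lower_Suc:
  assumes "v 0 = 0"
  shows "lower n N (Suc t) v ` {..n} = v ` {..n}"
proof (intro equalityI subsetI)
  fix y assume "y \<in> lower n N (Suc t) v ` {..n}"
  then show "y \<in> v ` {..n}" using assms by (auto simp: lower_def split: if_splits intro: rev_image_eqI)
next
  fix y assume "y \<in> v ` {..n}"
  then obtain q where q: "q \<le> n" "y = v q" by auto
  define r where "r = Max {r. r \<le> n \<and> v r = y}"
  have r: "r \<in> {r. r \<le> n \<and> v r = y}" unfolding r_def using q by (intro Max_in) auto
  show "y \<in> lower n N (Suc t) v ` {..n}"
  proof (cases "y = 0")
    case True
    then show ?thesis using r by (intro rev_image_eqI[of r]) (auto simp: lower_def)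
  next
    case False
    have "v r \<noteq> peak n N v (Suc t) r"
    proof
      assume "v r = peak n N v (Suc t) r"
      then obtain r' where "r' \<le> n" "v r' = y" "r < r'"
        using peak_Suc_attained[of n N v t r] False r by auto
      then have "r' \<le> r" unfolding r_def by (intro Max_ge) auto
      with \<open>r < r'\<close> show False by simp
    qed
    then show ?thesis using r by (intro rev_image_eqI[of r]) (auto simp: lower_def)
  qed
qed

lemma range_raise_Suc:
  assumes "v 0 = 0"
  shows "raise n N (Suc t) v ` {..n} = v ` {..n}"
proof (intro equalityI subsetI)
  fix y assume "y \<in> raise n N (Suc t) v ` {..n}"
  then obtain p where p: "p \<le> n" "y = raise n N (Suc t) v p" by auto
  show "y \<in> v ` {..n}"
  proof (cases "y = 0")
    case True
    then show ?thesis using assms by (intro rev_image_eqI[of 0]) auto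
  next
    case False
    show ?thesis
    proof (cases "v p = 0")
      case True
      then have y: "y = peak n N v (Suc t) p" using p by (simp add: raise_def)
      then obtain q where "q \<le> n" "v q = y" using peak_Suc_attained[of n N v t p] False by auto
      then show ?thesis by auto
    next
      case False
      then show ?thesis using p by (auto simp: raise_def)
    qed
  qed
next
  fix y assume "y \<in> v ` {..n}"
  then obtain q where q: "q \<le> n" "y = v q" by auto
  show "y \<in> raise n N (Suc t) v ` {..n}"
  proof (cases "y = 0")
    case True
    have "raise n N (Suc t) v 0 = 0" using assms peak_le[of n N v "Suc t" 0] by (simp add: raise_def)
    then show ?thesis using True by (intro rev_image_eqI[of 0]) auto
  next
    case False
    then show ?thesis using q by (intro rev_image_eqI[of q]) (auto simp: raise_def)
  qed
qed

lemma Max_attained: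
  fixes v :: "nat \<Rightarrow> nat"
  obtains q where "q \<le> n" "v q = Max (v ` {..n})"
proof -
  have "Max (v ` {..n}) \<in> v ` {..n}" by (rule Max_in) auto
  then show ?thesis using that by (metis (mono_tags) atMost_iff imageE)
qed

lemma Max_le_length:
  fixes v :: "nat \<Rightarrow> nat"
  assumes "\<And>p. v p \<le> p - 1"
  shows "Max (v ` {..n}) \<le> n"
proof -
  obtain q where q: "q \<le> n" "v q = Max (v ` {..n})" by (rule Max_attained[of n v])
  then have "v q \<le> n" using assms[of q] by linarith
  then show ?thesis by (simp only: q(2))
qed

section \<open>Invariance of the sequence conditions\<close>

lemma lower_le: "lower n N t v p \<le> v p"
  by (simp add: lower_def)

lemma fishburn_seqsD:
  assumes "v \<in> fishburn_seqs n"
  shows "v p \<le> p - 1" "n < p \<Longrightarrow> v p = 0" "v 0 = 0"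
    "1 \<le> p \<Longrightarrow> p < n \<Longrightarrow> p \<notin> v ` {..n} \<Longrightarrow> v p \<le> v (p + 1)"
proof -
  have *: "\<forall>p. v p \<le> p - 1" using assms by (simp add: fishburn_seqs_def)
  show "v p \<le> p - 1" using * by simp
  show "v 0 = 0" using spec[OF *, of 0] by simp
  show "n < p \<Longrightarrow> v p = 0" using assms by (simp add: fishburn_seqs_def)
  have "\<forall>p. 1 \<le> p \<and> p < n \<and> v (p + 1) < v p \<longrightarrow> p \<in> v ` {..n}"
    using assms by (simp add: fishburn_seqs_def)
  then show "1 \<le> p \<Longrightarrow> p < n \<Longrightarrow> p \<notin> v ` {..n} \<Longrightarrow> v p \<le> v (p + 1)"
    using not_le by blast
qed

text \<open>If no value equals \<open>p\<close>, the constraints \<open>v q < p\<close> and \<open>v q < p + 1\<close> agree.\<close>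

lemma peak_step_down:
  assumes "p \<notin> v ` {..n}"
  shows "peak n N v (Suc t) (p + 1) \<le> peak n N v (Suc t) p"
  unfolding peak_Suc_le_iff[of n N v t "p + 1"]
proof (intro allI impI, elim conjE)
  fix q assume q: "q \<le> n" "v q < p + 1" "p + 1 \<le> peak n N v t q"
  then have "v q < p" using assms by (metis atMost_iff image_eqI less_Suc_eq Suc_eq_plus1)
  then show "v q \<le> peak n N v (Suc t) p"
    using peak_Suc_le_iff[of n N v t p "peak n N v (Suc t) p"] q by simp
qed

text \<open>Passing from \<open>p\<close> to \<open>p + 1\<close> can lose only witnesses
  \<open>q\<close> with \<open>peak n N v t q = p\<close>. At positive level such a \<open>p\<close>
  would be a value of \<open>v\<close>; at level \<open>0\<close> it forces
  \<open>q = p + 1\<close>, which accounts for \<open>v (p + 1)\<close> in the bound.\<close>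

lemma peak_step_up:
  assumes "p \<notin> v ` {..n}" "1 \<le> p"
  shows "peak n N v (Suc t) p \<le> max (v (p + 1)) (peak n N v (Suc t) (p + 1))"
  unfolding peak_Suc_le_iff[of n N v t p]
proof (intro allI impI, elim conjE)
  fix q assume q: "q \<le> n" "v q < p" "p \<le> peak n N v t q"
  show "v q \<le> max (v (p + 1)) (peak n N v (Suc t) (p + 1))"
  proof (cases "p + 1 \<le> peak n N v t q")
    case True
    then have "v q \<le> peak n N v (Suc t) (p + 1)"
      using peak_Suc_le_iff[of n N v t "p + 1" "peak n N v (Suc t) (p + 1)"] q by simp
    then show ?thesis by simp
  next
    case False
    then have p: "p = peak n N v t q" using q by simp
    show ?thesis
    proof (cases t)
      case 0
      then have "q = p + 1" using p assms by (auto split: if_splits)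
      then show ?thesis by simp
    next
      case (Suc t')
      then have "0 < peak n N v (Suc t') q" "peak n N v (Suc t') q = p" using p assms(2) by simp_all
      then obtain r where "r \<le> n" "v r = p" by (metis peak_Suc_attained)
      then show ?thesis using assms(1) by auto
    qed
  qed
qed

text \<open>A new descent could only come from lowering \<open>v (p + 1)\<close> while
  \<open>v p\<close> stays. If \<open>p\<close> is no value, then
  \<open>v (p + 1) \<ge> v p\<close>, and \<open>v p\<close> exceeds its own peak, which bounds the
  peak at \<open>p + 1\<close> by \<open>peak_step_down\<close>; so \<open>v (p + 1)\<close> is not
  lowered either.\<close>

lemma lower_fishburn:
  assumes v: "v \<in> fishburn_seqs n" and pk: "\<forall>p\<le>n. peak n N v t p \<le> v p"
    and N: "N = n \<or> N = Max (v ` {..n})"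
  shows "lower n N t v \<in> fishburn_seqs n"
proof -
  note D = fishburn_seqsD[OF v]
  have "p \<in> lower n N t v ` {..n}"
    if p: "1 \<le> p" "p < n" "lower n N t v (p + 1) < lower n N t v p" for p
  proof (rule ccontr)
    assume nin: "p \<notin> lower n N t v ` {..n}"
    have gt: "peak n N v t p < v p"
      using p pk by (auto simp: lower_def intro: le_neq_implies_less split: if_splits)
    have lowp: "lower n N t v p = v p" using p by (auto simp: lower_def split: if_splits)
    show False
    proof (cases t)
      case 0
      \<comment> \<open>Up to \<open>N\<close> the peak of level \<open>0\<close> is
        \<open>p - 1\<close>, which \<open>v p\<close> cannot exceed. Beyond \<open>N\<close> there
        are no values of \<open>v\<close> below \<open>n\<close>, and nothing is lowered to a
        different value.\<close>
      then have "N < p" using gt D(1)[of p] by (auto split: if_splits)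
      moreover have "v q < p" if "N < p" "q \<le> n" "N = Max (v ` {..n})" for q
        using Max_ge[of "v ` {..n}" "v q"] that by auto
      ultimately have "p \<notin> v ` {..n}" using N p by auto
      then have "v p \<le> v (p + 1)" using D(4) p by simp
      moreover have "lower n N t v (p + 1) = v (p + 1)"
        using \<open>N < p\<close> 0 by (simp add: lower_def)
      ultimately show False using lowp p by simp
    next
      case (Suc t')
      then have nin: "p \<notin> v ` {..n}" using nin range_lower_Suc[of v n N t'] D(3) by simp
      then have le: "v p \<le> v (p + 1)" using D(4) p by simp
      moreover have "peak n N v t (p + 1) \<le> peak n N v t p"
        using peak_step_down[OF nin] Suc by simp
      ultimately have "lower n N t v (p + 1) = v (p + 1)" using gt by (simp add: lower_def)
      then show False using lowp p le by simp
    qed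
  qed
  moreover have "lower n N t v p \<le> p - 1" "n < p \<Longrightarrow> lower n N t v p = 0" for p
    using D(1,2)[of p] lower_le[of n N t v p] by auto
  ultimately show ?thesis unfolding fishburn_seqs_def by blast
qed

text \<open>On sequences of the low kind the raised entry is the maximum of the old entry and its
  peak. At positive level the raised entry at \<open>p + 1\<close> therefore dominates both
  \<open>v p\<close> and, by \<open>peak_step_up\<close>, the peak at \<open>p\<close>, provided
  \<open>p\<close> is no value.\<close>

lemma raise_fishburn:
  assumes v: "v \<in> fishburn_seqs n" and pk: "\<forall>p\<le>n. v p = 0 \<or> peak n N v t p < v p"
    and N: "N = n \<or> N = Max (v ` {..n})"
  shows "raise n N t v \<in> fishburn_seqs n"
proof -
  note D = fishburn_seqsD[OF v]
  have Nn: "N \<le> n" using N Max_le_length[of v n] D(1) by auto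
  have "p \<in> raise n N t v ` {..n}"
    if p: "1 \<le> p" "p < n" "raise n N t v (p + 1) < raise n N t v p" for p
  proof (rule ccontr)
    assume nin: "p \<notin> raise n N t v ` {..n}"
    show False
    proof (cases t)
      case 0
      have N': "N = n \<or> (\<exists>q\<le>n. v q = N)" using N Max_attained[of n v] by metis
      show False
      proof (cases "p < N")
        case True
        \<comment> \<open>A positive entry would have to exceed \<open>p - 1\<close> (respectively
          \<open>p\<close>), so both entries vanish and are raised to \<open>p - 1\<close> and
          \<open>p\<close>, an ascent.\<close>
        then have "v p = 0" "v (p + 1) = 0"
          using pk[rule_format, of p] pk[rule_format, of "p + 1"] p D(1)[of p] D(1)[of "p + 1"] 0
          by auto
        then show False using p True 0 by (simp add: raise_def)
      next
        case False
        \<comment> \<open>The boundary case \<open>p = N\<close> occurs only when \<open>N\<close>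
          is the largest value, as \<open>p < n\<close>. Then \<open>p\<close> is a value, and
          \<open>raise\<close> keeps it because it is positive.\<close>
        then have "p \<noteq> N \<or> 0 = N \<or> (\<exists>q\<le>n. v q = p)" using N' p by auto
        moreover have "\<exists>q\<le>n. raise n N t v q = p" if "\<exists>q\<le>n. v q = p"
          using that p by (auto simp: raise_def)
        ultimately have pN: "N < p" using False nin p by (metis atMost_iff image_eqI less_one linorder_neqE_nat not_less)
        then have "raise n N t v p = v p" "raise n N t v (p + 1) = v (p + 1)"
          using 0 by (auto simp: raise_def)
        then have "p \<in> v ` {..n}" using D(4)[of p] p by auto
        then obtain q where "q \<le> n" "v q = p" by auto
        then show False using nin p by (auto simp: raise_def)
      qed
    next
      case (Suc t')
      then have nin: "p \<notin> v ` {..n}" using nin range_raise_Suc[of v n N t'] D(3) by simp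
      have le: "v p \<le> v (p + 1)" using D(4) nin p by simp
      have up: "peak n N v t p \<le> max (v (p + 1)) (peak n N v t (p + 1))"
        using peak_step_up[OF nin] Suc p by simp
      have "v (p + 1) = 0 \<or> peak n N v t (p + 1) < v (p + 1)" using pk p by simp
      then show False using le up p by (auto simp: raise_def split: if_splits)
    qed
  qed
  moreover have "raise n N t v p \<le> p - 1" "n < p \<Longrightarrow> raise n N t v p = 0" for p
    using D(1,2)[of p] peak_le[of n N v t p] peak_outside[OF Nn, of p v t] by (auto simp: raise_def)
  ultimately show ?thesis unfolding fishburn_seqs_def by blast
qed

text \<open>When the bound is the largest value, the inverse map recomputes it from the changed
  sequence, so it has to be invariant.\<close>

lemma Max_lower:
  assumes v: "\<And>p. v p \<le> p - 1"
  shows "Max (lower n (Max (v ` {..n})) t v ` {..n}) = Max (v ` {..n})"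
proof (rule Max_eqI)
  define N where "N = Max (v ` {..n})"
  have N: "v p \<le> N" if "p \<le> n" for p unfolding N_def using that by (intro Max_ge) auto
  show "y \<le> Max (v ` {..n})" if "y \<in> lower n (Max (v ` {..n})) t v ` {..n}" for y
    using that N lower_le le_trans unfolding N_def by blast
  show "Max (v ` {..n}) \<in> lower n (Max (v ` {..n})) t v ` {..n}"
  proof (cases t)
    case 0
    obtain q where q: "q \<le> n" "v q = N" using Max_attained[of n v] N_def by blast
    \<comment> \<open>From \<open>N = v q \<le> q - 1\<close> it follows that \<open>q > N\<close>
      or \<open>N = 0\<close>; in both cases the peak of level \<open>0\<close> at \<open>q\<close>
      is \<open>0\<close>, so the entry keeps its value.\<close>
    have "lower n N t v q = N"
      using q v[of q] 0 by (auto simp: lower_def)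
    then show ?thesis using q unfolding N_def by (metis atMost_iff image_eqI)
  next
    case (Suc t')
    have "v 0 = 0" using v[of 0] by simp
    then show ?thesis using range_lower_Suc[of v n "Max (v ` {..n})" t'] Suc by simp
  qed
qed simp

lemma Max_raise:
  assumes v: "\<And>p. v p \<le> p - 1"
  shows "Max (raise n (Max (v ` {..n})) t v ` {..n}) = Max (v ` {..n})"
proof (rule Max_eqI)
  define N where "N = Max (v ` {..n})"
  have N: "v p \<le> N" if "p \<le> n" for p unfolding N_def using that by (intro Max_ge) auto
  obtain q where q: "q \<le> n" "v q = N" using Max_attained[of n v] N_def by blast
  have "v 0 = 0" using v[of 0] by simp
  then have R: "raise n N (Suc t') v ` {..n} = v ` {..n}" for t' by (rule range_raise_Suc)
  show "y \<le> Max (v ` {..n})" if y: "y \<in> raise n (Max (v ` {..n})) t v ` {..n}" for y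
  proof (cases t)
    case 0
    then show ?thesis using y N unfolding N_def by (auto simp: raise_def)
  next
    case (Suc t')
    then show ?thesis using R[of t'] y N unfolding N_def by auto
  qed
  show "Max (v ` {..n}) \<in> raise n (Max (v ` {..n})) t v ` {..n}"
  proof (cases "t = 0")
    case True
    have "raise n N t v q = N"
      using q v[of q] True by (auto simp: raise_def)
    then show ?thesis using q unfolding N_def by (metis atMost_iff image_eqI)
  next
    case False
    then obtain t' where "t = Suc t'" by (cases t) auto
    then show ?thesis using R[of t'] q unfolding N_def by auto
  qed
qed simp

lemma card_low_high:
  assumes "Nf = (\<lambda>_. n) \<or> Nf = (\<lambda>v. Max (v ` {..n}))"
  shows "card (low_seqs n Nf t) = card (high_seqs n Nf t)"
proof (rule bij_betw_same_card[OF bij_betwI])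
  let ?r = "\<lambda>v. raise n (Nf v) t v" and ?l = "\<lambda>v. lower n (Nf v) t v"
  have Nl: "Nf (?l v) = Nf v" and Nr: "Nf (?r v) = Nf v" if "v \<in> fishburn_seqs n" for v
    using assms Max_lower[of v] Max_raise[of v] fishburn_seqsD(1)[OF that] by auto
  have N: "Nf v = n \<or> Nf v = Max (v ` {..n})" for v using assms by auto
  have Nn: "Nf v \<le> n" if "v \<in> fishburn_seqs n" for v
    using N[of v] Max_le_length[of v n] fishburn_seqsD(1)[OF that] by auto
  have out: "\<forall>p>n. v p = 0" if "v \<in> fishburn_seqs n" for v
    using fishburn_seqsD(2)[OF that] by auto
  show "?r \<in> low_seqs n Nf t \<rightarrow> high_seqs n Nf t"
    using raise_fishburn[OF _ _ N] Nr
    by (auto simp: low_seqs_def high_seqs_def peak_raise) (auto simp: raise_def)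
  show "?l \<in> high_seqs n Nf t \<rightarrow> low_seqs n Nf t"
    using lower_fishburn[OF _ _ N] Nl
    by (auto simp: low_seqs_def high_seqs_def peak_lower)
      (auto simp: lower_def split: if_splits intro: le_neq_implies_less)
  show "?l (?r v) = v" if "v \<in> low_seqs n Nf t" for v
    using that lower_raise[where n = n and N = "Nf v" and v = v and t = t] Nr[of v] Nn out by (auto simp: low_seqs_def)
  show "?r (?l v) = v" if "v \<in> high_seqs n Nf t" for v
    using that raise_lower[where n = n and N = "Nf v" and v = v and t = t] Nl[of v] Nn out by (auto simp: high_seqs_def)
qed

section \<open>Coding matchings by sequences\<close>

text \<open>The positions of the \<open>p\<close>-th closer and of its opener when \<open>v p\<close> closers precede that opener and
  the openers between two consecutive closers are ordered like their closers.\<close>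

definition cls :: "nat \<Rightarrow> (nat \<Rightarrow> nat) \<Rightarrow> nat \<Rightarrow> nat" where
  "cls n v p = p + card {q \<in> {1..n}. v q < p}"

definition opn :: "nat \<Rightarrow> (nat \<Rightarrow> nat) \<Rightarrow> nat \<Rightarrow> nat" where
  "opn n v p = v p + card {q \<in> {1..n}. v q < v p \<or> v q = v p \<and> q \<le> p}"

definition seq_matching :: "nat \<Rightarrow> (nat \<Rightarrow> nat) \<Rightarrow> nat set set" where
  "seq_matching n v = (\<lambda>p. {opn n v p, cls n v p}) ` {1..n}"

lemma cls_less_cls: "p < q \<Longrightarrow> cls n v p < cls n v q"
proof -
  assume "p < q"
  then have "card {r \<in> {1..n}. v r < p} \<le> card {r \<in> {1..n}. v r < q}"
    by (intro card_mono) auto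
  then show ?thesis using \<open>p < q\<close> by (simp add: cls_def)
qed

lemma cls_less_cls_iff: "cls n v p < cls n v q \<longleftrightarrow> p < q"
  by (metis cls_less_cls less_asym' linorder_neqE_nat)

lemma opn_less_cls: "v p < q \<Longrightarrow> opn n v p < cls n v q"
proof -
  assume "v p < q"
  then have "card {r \<in> {1..n}. v r < v p \<or> v r = v p \<and> r \<le> p} \<le> card {r \<in> {1..n}. v r < q}"
    by (intro card_mono) auto
  then show ?thesis using \<open>v p < q\<close> by (simp add: cls_def opn_def)
qed

lemma cls_less_opn: "p \<in> {1..n} \<Longrightarrow> q \<le> v p \<Longrightarrow> cls n v q < opn n v p"
proof -
  assume "p \<in> {1..n}" "q \<le> v p"
  then have "card {r \<in> {1..n}. v r < q} < card {r \<in> {1..n}. v r < v p \<or> v r = v p \<and> r \<le> p}"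
    by (intro psubset_card_mono) auto
  then show ?thesis using \<open>q \<le> v p\<close> by (simp add: cls_def opn_def)
qed

lemma opn_less_cls_iff: "p \<in> {1..n} \<Longrightarrow> opn n v p < cls n v q \<longleftrightarrow> v p < q"
  using opn_less_cls[of v p q n] cls_less_opn[of p n q v] by (metis less_asym not_le)

lemma cls_less_opn_iff: "p \<in> {1..n} \<Longrightarrow> cls n v q < opn n v p \<longleftrightarrow> q \<le> v p"
  using opn_less_cls[of v p q n] cls_less_opn[of p n q v] by (metis less_asym not_le)

lemma opn_less_opn:
  assumes "q \<in> {1..n}" "v p < v q \<or> v p = v q \<and> p < q"
  shows "opn n v p < opn n v q"
proof -
  have "card {r \<in> {1..n}. v r < v p \<or> v r = v p \<and> r \<le> p}
      < card {r \<in> {1..n}. v r < v q \<or> v r = v q \<and> r \<le> q}"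
  proof (rule psubset_card_mono)
    have "q \<in> {r \<in> {1..n}. v r < v q \<or> v r = v q \<and> r \<le> q}"
      "q \<notin> {r \<in> {1..n}. v r < v p \<or> v r = v p \<and> r \<le> p}" using assms by auto
    moreover have "v r < v q \<or> v r = v q \<and> r \<le> q" if "v r < v p \<or> v r = v p \<and> r \<le> p" for r
      using that assms(2) by linarith
    ultimately show "{r \<in> {1..n}. v r < v p \<or> v r = v p \<and> r \<le> p}
      \<subset> {r \<in> {1..n}. v r < v q \<or> v r = v q \<and> r \<le> q}" by blast
  qed simp
  then show ?thesis using assms by (auto simp: opn_def)
qed

lemma opn_less_opn_iff:
  assumes "p \<in> {1..n}" "q \<in> {1..n}"
  shows "opn n v p < opn n v q \<longleftrightarrow> v p < v q \<or> v p = v q \<and> p < q"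
proof
  assume less: "opn n v p < opn n v q"
  show "v p < v q \<or> v p = v q \<and> p < q"
  proof (rule ccontr)
    assume "\<not> (v p < v q \<or> v p = v q \<and> p < q)"
    then have "p = q \<or> v q < v p \<or> v q = v p \<and> q < p" by linarith
    then have "opn n v q \<le> opn n v p" using opn_less_opn[of p n v q] assms(1) by fastforce
    then show False using less by simp
  qed
qed (use opn_less_opn assms in blast)

lemma opn_inj: "inj_on (opn n v) {1..n}"
  by (rule inj_onI) (metis opn_less_opn less_irrefl linorder_neqE_nat)

lemma cls_inj: "inj (cls n v)"
  by (rule injI) (metis cls_less_cls less_irrefl linorder_neqE_nat)

lemma opn_neq_cls: "p \<in> {1..n} \<Longrightarrow> opn n v p \<noteq> cls n v q"
  using opn_less_cls[of v p q n] cls_less_opn[of p n q v] by (metis less_irrefl not_le)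

lemma opn_less_cls_same: "v p \<le> p - 1 \<Longrightarrow> p \<in> {1..n} \<Longrightarrow> opn n v p < cls n v p"
  by (rule opn_less_cls) auto

text \<open>Openers and closers are two disjoint injective families of \<open>n\<close> positions
  each inside \<open>{1..2 * n}\<close>, so they cover it by counting.\<close>

lemma seq_matching_is_matching:
  assumes v: "\<And>p. v p \<le> p - 1"
  shows "is_matching n (seq_matching n v)"
proof -
  let ?E = "opn n v ` {1..n} \<union> cls n v ` {1..n}"
  have sub: "?E \<subseteq> {1..2 * n}"
  proof -
    have "1 \<le> opn n v p \<and> opn n v p \<le> 2 * n" if "p \<in> {1..n}" for p
    proof -
      have "card {q \<in> {1..n}. v q < v p \<or> v q = v p \<and> q \<le> p} \<le> card {1..n}"
        by (intro card_mono) auto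
      moreover have "0 < card {q \<in> {1..n}. v q < v p \<or> v q = v p \<and> q \<le> p}"
        using that by (subst card_gt_0_iff) auto
      ultimately show ?thesis using v[of p] that by (auto simp: opn_def)
    qed
    moreover have "1 \<le> cls n v p \<and> cls n v p \<le> 2 * n" if "p \<in> {1..n}" for p
    proof -
      have "card {q \<in> {1..n}. v q < p} \<le> card {1..n}" by (intro card_mono) auto
      then show ?thesis using that by (auto simp: cls_def)
    qed
    ultimately show ?thesis by auto
  qed
  moreover have "card ?E = 2 * n"
  proof -
    have "card ?E = card (opn n v ` {1..n}) + card (cls n v ` {1..n})"
      using opn_neq_cls[of _ n v] by (intro card_Un_disjoint) blast+
    also have "\<dots> = n + n"
      using card_image[OF opn_inj[of n v]] card_image[OF inj_on_subset[OF cls_inj[of n v] subset_UNIV]]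
      by simp
    finally show ?thesis by simp
  qed
  ultimately have E: "?E = {1..2 * n}" by (intro card_subset_eq) auto
  have "\<Union>(seq_matching n v) = ?E" by (auto simp: seq_matching_def)
  moreover have "disjoint (seq_matching n v)"
  proof (rule disjointI)
    fix X Y assume "X \<in> seq_matching n v" "Y \<in> seq_matching n v" "X \<noteq> Y"
    then obtain p q where pq: "p \<in> {1..n}" "q \<in> {1..n}"
      "X = {opn n v p, cls n v p}" "Y = {opn n v q, cls n v q}"
      unfolding seq_matching_def by blast
    then have "p \<noteq> q" using \<open>X \<noteq> Y\<close> by blast
    then show "X \<inter> Y = {}"
      using opn_neq_cls[of p n v q] opn_neq_cls[of q n v p] inj_onD[OF opn_inj, of n v p q]
        injD[OF cls_inj, of n v p q] pq by auto
  qed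
  moreover have "card X = 2" if "X \<in> seq_matching n v" for X
  proof -
    obtain p where "p \<in> {1..n}" "X = {opn n v p, cls n v p}"
      using \<open>X \<in> seq_matching n v\<close> by (auto simp: seq_matching_def)
    then show ?thesis using opn_neq_cls[of p n v p] by simp
  qed
  ultimately show ?thesis using E unfolding is_matching_def partition_on_def
    by (auto simp: seq_matching_def)
qed

lemma seq_matching_arcs:
  assumes "\<And>p. v p \<le> p - 1"
  shows "{x, y} \<in> seq_matching n v \<and> x < y \<longleftrightarrow> (\<exists>p\<in>{1..n}. x = opn n v p \<and> y = cls n v p)"
proof
  assume "{x, y} \<in> seq_matching n v \<and> x < y"
  then obtain p where p: "p \<in> {1..n}" "{x, y} = {opn n v p, cls n v p}" and "x < y"
    by (auto simp: seq_matching_def)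
  moreover have "opn n v p < cls n v p" using p assms by (intro opn_less_cls_same) auto
  ultimately show "\<exists>p\<in>{1..n}. x = opn n v p \<and> y = cls n v p"
    by (metis doubleton_eq_iff less_asym)
next
  assume "\<exists>p\<in>{1..n}. x = opn n v p \<and> y = cls n v p"
  then show "{x, y} \<in> seq_matching n v \<and> x < y"
    using opn_less_cls_same assms by (auto simp: seq_matching_def)
qed

text \<open>Openers in the same gap are ordered by their closers, so a reversed adjacent pair would
  need different values of \<open>v\<close>; then the closer with index \<open>v q\<close> would lie
  strictly between two consecutive positions.\<close>

lemma seq_matching_not_type_I:
  assumes v: "\<And>p. v p \<le> p - 1"
  shows "\<not> type_I (seq_matching n v)"
proof
  assume "type_I (seq_matching n v)"
  then obtain i k l where ik: "{i, l} \<in> seq_matching n v" "{i + 1, k} \<in> seq_matching n v"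
    "i + 1 < k" "k < l" unfolding type_I_def by blast
  then obtain p q where p: "p \<in> {1..n}" "i = opn n v p" "l = cls n v p"
    and q: "q \<in> {1..n}" "i + 1 = opn n v q" "k = cls n v q"
    using seq_matching_arcs[OF v, of i l n] seq_matching_arcs[OF v, of "i + 1" k n] by auto
  have "q < p" using ik p q cls_less_cls_iff by simp
  moreover have "opn n v p < opn n v q" using p q by simp
  ultimately have "v p < v q" using p q opn_less_opn_iff[of p n q v] by auto
  then have "opn n v p < cls n v (v q)" "cls n v (v q) < opn n v q"
    using p q opn_less_cls cls_less_opn by auto
  then show False using p q by simp
qed

text \<open>An opener separates the closers \<open>p\<close> and \<open>p + 1\<close> exactly when
  its value is \<open>p\<close>. The openers of these two arcs are reversed exactly at a strict
  descent, because ties are ordered by closer.\<close>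

lemma seq_matching_type_II_iff:
  assumes v: "\<And>p. v p \<le> p - 1"
  shows "type_II (seq_matching n v) \<longleftrightarrow>
    (\<exists>p. 1 \<le> p \<and> p < n \<and> v (p + 1) < v p \<and> p \<notin> v ` {..n})"
proof
  assume "type_II (seq_matching n v)"
  then obtain j k l where jk: "{k, j + 1} \<in> seq_matching n v" "{l, j} \<in> seq_matching n v"
    "k < l" "l < j" unfolding type_II_def by blast
  then obtain p q where p: "p \<in> {1..n}" "k = opn n v p" "j + 1 = cls n v p"
    and q: "q \<in> {1..n}" "l = opn n v q" "j = cls n v q"
    using seq_matching_arcs[OF v, of k "j + 1" n] seq_matching_arcs[OF v, of l j n] by auto
  have "q < p" using p q cls_less_cls_iff[of n v q p] by simp
  moreover have "\<not> q + 1 < p"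
  proof
    assume "q + 1 < p"
    then have "cls n v q < cls n v (q + 1)" "cls n v (q + 1) < cls n v p"
      by (auto intro: cls_less_cls)
    then show False using p q by simp
  qed
  ultimately have pq: "p = q + 1" by simp
  have "opn n v p < opn n v q" using jk p q by simp
  then have "v p < v q" using p q pq opn_less_opn_iff[of p n q v] by auto
  moreover have "q \<notin> v ` {..n}"
  proof
    assume "q \<in> v ` {..n}"
    then obtain r where r: "r \<le> n" "v r = q" by auto
    then have "r \<in> {1..n}" using q v[of r] by auto
    then have "cls n v q < opn n v r" "opn n v r < cls n v p"
      using r pq by (auto intro: cls_less_opn opn_less_cls)
    then show False using p q by simp
  qed
  ultimately show "\<exists>p. 1 \<le> p \<and> p < n \<and> v (p + 1) < v p \<and> p \<notin> v ` {..n}"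
    using pq p q by (intro exI[of _ q]) auto
next
  assume "\<exists>p. 1 \<le> p \<and> p < n \<and> v (p + 1) < v p \<and> p \<notin> v ` {..n}"
  then obtain p where p: "1 \<le> p" "p < n" "v (p + 1) < v p" "p \<notin> v ` {..n}" by blast
  have "v q < p + 1 \<longleftrightarrow> v q < p" if "q \<in> {1..n}" for q
    using p that by (metis atLeastAtMost_iff atMost_iff image_eqI less_Suc_eq Suc_eq_plus1)
  then have eq: "{q \<in> {1..n}. v q < p + 1} = {q \<in> {1..n}. v q < p}" by blast
  have *: "{opn n v q, cls n v q} \<in> seq_matching n v" if "1 \<le> q" "q \<le> n" for q
    using that by (auto simp: seq_matching_def)
  have "cls n v (p + 1) = cls n v p + 1" using eq by (simp add: cls_def)
  moreover have "opn n v (p + 1) < opn n v p" using p by (intro opn_less_opn) auto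
  moreover have "opn n v p < cls n v p" using p v by (intro opn_less_cls_same) auto
  moreover have "{opn n v p, cls n v p} \<in> seq_matching n v"
    "{opn n v (p + 1), cls n v (p + 1)} \<in> seq_matching n v" using p by (auto intro: *)
  ultimately show "type_II (seq_matching n v)"
    unfolding type_II_def by metis
qed

lemma seq_matching_stoimenow:
  assumes "v \<in> fishburn_seqs n"
  shows "seq_matching n v \<in> stoimenow_matchings n"
  using assms seq_matching_is_matching[of v n] seq_matching_not_type_I[of v n]
    seq_matching_type_II_iff[of v n]
  unfolding stoimenow_matchings_def fishburn_seqs_def by blast

section \<open>The coding is a bijection\<close>

lemma strict_mono_same_image:
  fixes f g :: "nat \<Rightarrow> nat"
  assumes f: "\<And>p q. p < q \<Longrightarrow> f p < f q" and g: "\<And>p q. p < q \<Longrightarrow> g p < g q"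
    and im: "f ` {1..n} = g ` {1..n}" and p: "p \<in> {1..n}"
  shows "f p = g p"
proof -
  define h where "h q = (SOME r. r \<in> {1..n} \<and> f q = g r)" for q
  have h: "h q \<in> {1..n} \<and> f q = g (h q)" if "q \<in> {1..n}" for q
  proof -
    have "\<exists>r. r \<in> {1..n} \<and> f q = g r" using im that by (metis imageE image_eqI)
    then show ?thesis unfolding h_def by (rule someI_ex)
  qed
  have "h p = p"
  proof (rule strict_mono_on_interval_id[of n])
    show "h j < h (j + 1)" if "1 \<le> j" "j < n" for j
    proof -
      have "g (h j) < g (h (j + 1))" using h[of j] h[of "j + 1"] f[of j "j + 1"] that by simp
      then show ?thesis using g by (metis less_asym linorder_neqE_nat less_irrefl)
    qed
  qed (use h p in auto)
  then show ?thesis using h p by metis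
qed

text \<open>Closers are recognised as the larger elements of their blocks, so equal matchings have
  equal closers in increasing order, hence equal openers. Finally \<open>v p\<close> is recovered by
  comparing an opener with all closers.\<close>

lemma inj_on_seq_matching: "inj_on (seq_matching n) (fishburn_seqs n)"
proof (rule inj_onI)
  fix v w assume v: "v \<in> fishburn_seqs n" and w: "w \<in> fishburn_seqs n"
    and eq: "seq_matching n v = seq_matching n w"
  note V = fishburn_seqsD[OF v] and W = fishburn_seqsD[OF w]
  have arcs: "(\<exists>p\<in>{1..n}. x = opn n v p \<and> y = cls n v p) \<longleftrightarrow>
      (\<exists>p\<in>{1..n}. x = opn n w p \<and> y = cls n w p)" for x y
    unfolding seq_matching_arcs[of v, OF V(1), symmetric] seq_matching_arcs[of w, OF W(1), symmetric] eq ..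
  then have "cls n v ` {1..n} = cls n w ` {1..n}" by blast
  then have C: "cls n v p = cls n w p" if "p \<in> {1..n}" for p
    using strict_mono_same_image[of "cls n v" "cls n w" n p] that cls_less_cls by blast
  have O: "opn n v p = opn n w p" if "p \<in> {1..n}" for p
  proof -
    have "\<exists>r\<in>{1..n}. opn n v p = opn n v r \<and> cls n v p = cls n v r" using that by blast
    then obtain q where "q \<in> {1..n}" "opn n v p = opn n w q" "cls n v p = cls n w q"
      unfolding arcs by blast
    then show ?thesis using C that injD[OF cls_inj, of n w p q] by simp
  qed
  show "v = w"
  proof
    fix p
    show "v p = w p"
    proof (cases "p \<in> {1..n}")
      case True
      have "q \<le> v p \<longleftrightarrow> q \<le> w p" if "q \<in> {1..n}" for q
        using cls_less_opn_iff[of p n v q] cls_less_opn_iff[of p n w q] C O True that by simp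
      moreover have "v p \<le> n" "w p \<le> n" using V(1)[of p] W(1)[of p] True by auto
      ultimately show ?thesis
        by (intro le_antisym_pos) (metis atLeastAtMost_iff le_trans)
    next
      case False
      then show ?thesis using V(2)[of p] V(3) W(2)[of p] W(3) by (cases "p = 0") auto
    qed
  qed
qed

text \<open>The type I condition only compares adjacent openers; it propagates through a run of openers.\<close>

lemma arcs_eq_seq_matching:
  fixes opener closer :: "nat \<Rightarrow> nat"
  assumes mono: "\<And>p q. p \<in> {1..n} \<Longrightarrow> q \<in> {1..n} \<Longrightarrow> p < q \<Longrightarrow> closer p < closer q"
    and inj: "inj_on opener {1..n}"
    and cover: "opener ` {1..n} \<union> closer ` {1..n} = {1..2 * n}"
    and disj: "opener ` {1..n} \<inter> closer ` {1..n} = {}"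
    and less: "\<And>p. p \<in> {1..n} \<Longrightarrow> opener p < closer p"
    and adj: "\<And>p q. p \<in> {1..n} \<Longrightarrow> q \<in> {1..n} \<Longrightarrow> opener q = opener p + 1 \<Longrightarrow> p < q"
  obtains v where "\<And>p. v p \<le> p - 1" "\<And>p. n < p \<Longrightarrow> v p = 0"
    "\<And>p. p \<in> {1..n} \<Longrightarrow> opener p = opn n v p \<and> closer p = cls n v p"
proof -
  define C where "C = closer ` {1..n}"
  define O' where "O' = opener ` {1..n}"
  have fin: "finite C" "finite O'" by (simp_all add: C_def O'_def)
  have mono_iff: "closer p < closer q \<longleftrightarrow> p < q" if "p \<in> {1..n}" "q \<in> {1..n}" for p q
    using mono[of p q] mono[of q p] that by (metis less_asym linorder_neqE_nat)
  have cinj: "inj_on closer {1..n}"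
  proof (rule inj_onI)
    fix p q assume "p \<in> {1..n}" "q \<in> {1..n}" "closer p = closer q"
    then show "p = q" using mono[of p q] mono[of q p] by (cases p q rule: linorder_cases) auto
  qed
  have cardle: "card {c \<in> C. c \<le> closer p} = p" if p: "p \<in> {1..n}" for p
  proof -
    have "closer q \<le> closer p \<longleftrightarrow> q \<le> p" if "q \<in> {1..n}" for q
      using mono_iff[OF p that] by linarith
    then have "{c \<in> C. c \<le> closer p} = closer ` {q \<in> {1..n}. q \<le> p}"
      unfolding C_def by blast
    moreover have "{q \<in> {1..n}. q \<le> p} = {1..p}" using p by auto
    ultimately have "{c \<in> C. c \<le> closer p} = closer ` {1..p}" by simp
    moreover have "inj_on closer {1..p}" using inj_on_subset[OF cinj, of "{1..p}"] p by auto
    ultimately show ?thesis by (simp add: card_image)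
  qed
  define v where "v p = (if p \<in> {1..n} then card {c \<in> C. c < opener p} else 0)" for p
  have neq: "opener p \<noteq> closer q" if "p \<in> {1..n}" "q \<in> {1..n}" for p q
    using disj that by blast
  have v_ge: "q \<le> v p" if "p \<in> {1..n}" "q \<in> {1..n}" "closer q < opener p" for p q
  proof -
    have "card {c \<in> C. c \<le> closer q} \<le> card {c \<in> C. c < opener p}"
      using fin that by (intro card_mono) auto
    then show ?thesis using that cardle[of q] by (simp add: v_def)
  qed
  have v_less: "v p < q" if "p \<in> {1..n}" "q \<in> {1..n}" "opener p < closer q" for p q
  proof -
    have "closer q \<in> {c \<in> C. c \<le> closer q}" "closer q \<notin> {c \<in> C. c < opener p}"
      using that by (auto simp: C_def)
    moreover have "{c \<in> C. c < opener p} \<subseteq> {c \<in> C. c \<le> closer q}" using that by auto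
    ultimately have "card {c \<in> C. c < opener p} < card {c \<in> C. c \<le> closer q}"
      using fin by (intro psubset_card_mono) auto
    then show ?thesis using that cardle[of q] by (simp add: v_def)
  qed
  have oc: "opener p < closer q \<longleftrightarrow> v p < q" if "p \<in> {1..n}" "q \<in> {1..n}" for p q
    using v_ge[of p q] v_less[of p q] neq[of p q] that by linarith
  have run: "p < q" if "p \<in> {1..n}" "q \<in> {1..n}" "opener q = opener p + Suc d"
    "\<forall>c\<in>C. \<not> (opener p < c \<and> c < opener q)" for p q d
    using that
  proof (induction d arbitrary: q)
    case 0
    then show ?case using adj by simp
  next
    case (Suc d)
    \<comment> \<open>The position just before \<open>opener q\<close> is not a closer, hence an
      opener; it links the shorter run to \<open>q\<close>.\<close>
    have "opener p + Suc d \<in> {1..2 * n}" "opener p + Suc d \<notin> C"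
    proof -
      have "opener q \<in> {1..2 * n}" using cover Suc.prems(2) by blast
      then show "opener p + Suc d \<in> {1..2 * n}" using Suc.prems(3) by simp
      show "opener p + Suc d \<notin> C" using Suc.prems(3,4) by auto
    qed
    then obtain r where r: "r \<in> {1..n}" "opener r = opener p + Suc d"
      using cover unfolding C_def by (metis UnE imageE)
    moreover have "\<forall>c\<in>C. \<not> (opener p < c \<and> c < opener r)"
      using Suc.prems(3,4) r(2) by (metis less_SucI add_Suc_right)
    ultimately have "p < r" using Suc.IH[of r] Suc.prems(1) by blast
    moreover have "r < q" using adj[of r q] r Suc.prems by simp
    ultimately show ?case by simp
  qed
  have oo1: "v p < v q \<or> v p = v q \<and> p < q"
    if pq: "p \<in> {1..n}" "q \<in> {1..n}" "opener p < opener q" for p q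
  proof (cases "\<exists>c\<in>C. opener p < c \<and> c < opener q")
    case True
    then obtain r where "r \<in> {1..n}" "opener p < closer r" "closer r < opener q"
      by (auto simp: C_def)
    then have "v p < r" "r \<le> v q" using v_less v_ge pq by auto
    then show ?thesis by simp
  next
    case False
    obtain d where "opener q = opener p + Suc d" using pq less_imp_Suc_add by auto
    then have "p < q" using run[of p q d] False pq by blast
    moreover have "card {c \<in> C. c < opener p} \<le> card {c \<in> C. c < opener q}"
      using fin pq by (intro card_mono) auto
    ultimately show ?thesis using pq by (auto simp: v_def)
  qed
  have oo: "opener q \<le> opener p \<longleftrightarrow> v q < v p \<or> v q = v p \<and> q \<le> p"
    if "p \<in> {1..n}" "q \<in> {1..n}" for p q
  proof (cases "p = q")
    case False
    then have "opener p \<noteq> opener q" using inj that by (auto dest: inj_onD)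
    then show ?thesis using oo1[of p q] oo1[of q p] that False by linarith
  qed simp
  \<comment> \<open>A position is its own rank among all endpoints. Split into closers and openers,
    this rank becomes the formulas of \<open>cls\<close> and \<open>opn\<close>.\<close>
  have pos: "x = card {c \<in> C. c \<le> x} + card {q \<in> {1..n}. opener q \<le> x}" if "x \<in> {1..2 * n}" for x
  proof -
    have "{1..x} = {c \<in> C. c \<le> x} \<union> {c \<in> O'. c \<le> x}"
      using cover that unfolding C_def O'_def by auto
    moreover have "{c \<in> C. c \<le> x} \<inter> {c \<in> O'. c \<le> x} = {}"
      using disj unfolding C_def O'_def by blast
    ultimately have "card {1..x} = card {c \<in> C. c \<le> x} + card {c \<in> O'. c \<le> x}"
      using fin by (simp add: card_Un_disjoint)
    moreover have "{c \<in> O'. c \<le> x} = opener ` {q \<in> {1..n}. opener q \<le> x}"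
      unfolding O'_def by blast
    moreover have "inj_on opener {q \<in> {1..n}. opener q \<le> x}" by (rule inj_on_subset[OF inj]) blast
    ultimately show ?thesis by (simp add: card_image)
  qed
  show ?thesis
  proof (rule that[of v])
    show "v p \<le> p - 1" for p
      using less[of p] v_less[of p p] by (cases "p \<in> {1..n}") (auto simp: v_def)
    show "n < p \<Longrightarrow> v p = 0" for p by (simp add: v_def)
    show "opener p = opn n v p \<and> closer p = cls n v p" if p: "p \<in> {1..n}" for p
    proof
      have "opener p \<in> {1..2 * n}" "closer p \<in> {1..2 * n}" using cover p by blast+
      note pos = this[THEN pos]
      have "opener p \<notin> C" using disj p unfolding C_def by blast
      then have "{c \<in> C. c \<le> opener p} = {c \<in> C. c < opener p}" by (auto simp: le_less)
      then have "card {c \<in> C. c \<le> opener p} = v p" using p by (simp add: v_def)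
      moreover have "{q \<in> {1..n}. opener q \<le> opener p} = {q \<in> {1..n}. v q < v p \<or> v q = v p \<and> q \<le> p}"
        using oo[OF p] by blast
      ultimately show "opener p = opn n v p" using pos(1) unfolding opn_def by simp
      have "{q \<in> {1..n}. opener q \<le> closer p} = {q \<in> {1..n}. v q < p}"
        using oc[OF _ p] neq[OF _ p] by (metis (no_types, lifting) le_less)
      then show "closer p = cls n v p" using pos(2) cardle[OF p] unfolding cls_def by simp
    qed
  qed
qed

lemma is_matching_arcD:
  assumes M: "is_matching n M" and B: "{x, y} \<in> M"
  shows "x \<noteq> y" "x \<in> {1..2 * n}" "y \<in> {1..2 * n}" "{x, z} \<in> M \<Longrightarrow> z = y" "{z, y} \<in> M \<Longrightarrow> z = x"
proof -
  have c: "card B = 2" if "B \<in> M" for B using M that by (simp add: is_matching_def)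
  have U: "\<Union>M = {1..2 * n}" and d: "disjoint M"
    using M by (auto simp: is_matching_def partition_on_def)
  show "x \<noteq> y" using c[OF B] by auto
  show "x \<in> {1..2 * n}" "y \<in> {1..2 * n}" using B U by blast+
  show "z = y" if "{x, z} \<in> M"
  proof -
    have "{x, z} = {x, y}" using disjointD[OF d that B] by blast
    then show ?thesis by (metis doubleton_eq_iff)
  qed
  show "z = x" if "{z, y} \<in> M"
  proof -
    have "{z, y} = {x, y}" using disjointD[OF d that B] by blast
    then show ?thesis by (metis doubleton_eq_iff)
  qed
qed

lemma is_matching_arcE:
  assumes "is_matching n M" "x \<in> {1..2 * n}"
  obtains y where "{x, y} \<in> M"
proof -
  obtain B where B: "B \<in> M" "x \<in> B"
    using assms unfolding is_matching_def partition_on_def by blast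
  then have "card B = 2" using assms by (simp add: is_matching_def)
  then obtain a b where "B = {a, b}" by (auto simp: card_2_iff)
  then show ?thesis using that B by (auto simp: insert_commute)
qed

lemma is_matching_arc_form:
  assumes "is_matching n M" "B \<in> M"
  obtains x y where "B = {x, y}" "x < y"
proof -
  have "card B = 2" using assms by (simp add: is_matching_def)
  then obtain a b where "B = {a, b}" "a \<noteq> b" by (auto simp: card_2_iff)
  then show ?thesis using that by (metis insert_commute linorder_neqE_nat)
qed

lemma stoimenow_eq_seq_matching:
  assumes M: "M \<in> stoimenow_matchings n"
  obtains v where "v \<in> fishburn_seqs n" "M = seq_matching n v"
proof -
  have m: "is_matching n M" and nI: "\<not> type_I M" and nII: "\<not> type_II M"
    using M by (auto simp: stoimenow_matchings_def)
  note arcD = is_matching_arcD[OF m]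
  define C where "C = {y. \<exists>x<y. {x, y} \<in> M}"
  define partner where "partner y = (THE x. {x, y} \<in> M)" for y
  have partner: "partner y = x" if "{x, y} \<in> M" for x y
    unfolding partner_def
  proof (rule the_equality)
    show "z = x" if "{z, y} \<in> M" for z by (rule arcD(5)[OF \<open>{x, y} \<in> M\<close> that])
  qed (rule that)
  have C: "{partner y, y} \<in> M \<and> partner y < y" if "y \<in> C" for y
    using that partner unfolding C_def by auto
  have Csub: "C \<subseteq> {1..2 * n}" using C arcD(3) by blast
  then have finC: "finite C" by (rule finite_subset) simp
  have inj: "inj_on partner C"
  proof (rule inj_onI)
    fix y z assume yz: "y \<in> C" "z \<in> C" "partner y = partner z"
    show "y = z" using arcD(4)[of "partner y" y z] C yz by metis
  qed
  have disj: "partner ` C \<inter> C = {}"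
  proof -
    have False if "y \<in> C" "z \<in> C" "z = partner y" for y z
    proof -
      have "{z, y} \<in> M" "{z, partner z} \<in> M" using C that by (auto simp: insert_commute)
      then have "partner z = y" using arcD(4)[of z y "partner z"] by simp
      then show False using C[of y] C[of z] that by simp
    qed
    then show ?thesis by blast
  qed
  have cover: "partner ` C \<union> C = {1..2 * n}"
  proof (intro equalityI subsetI)
    fix x assume "x \<in> partner ` C \<union> C"
    then show "x \<in> {1..2 * n}" using Csub C arcD(2) by blast
  next
    fix x assume "x \<in> {1..2 * n}"
    then obtain y where y: "{x, y} \<in> M" by (rule is_matching_arcE[OF m])
    then consider "x < y" | "y < x" using arcD(1)[OF y] by linarith
    then show "x \<in> partner ` C \<union> C"
    proof cases
      case 1
      then have "y \<in> C" using y by (auto simp: C_def)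
      then show ?thesis using partner[OF y] by blast
    next
      case 2
      then show ?thesis using y by (auto simp: C_def insert_commute)
    qed
  qed
  have "card (partner ` C \<union> C) = card C + card C"
    using finC disj inj by (simp add: card_Un_disjoint card_image)
  then have cardC: "card C = n" using cover by simp
  obtain h where h: "bij_betw h {..<n} C" "strict_mono_on {..<n} h"
    using ex_bij_betw_strict_mono_card[OF finC] cardC by auto
  \<comment> \<open>The enumeration \<open>h\<close> starts at \<open>0\<close>, whereas closer
    indices start at \<open>1\<close>.\<close>
  define closer where "closer p = h (p - 1)" for p
  define opener where "opener p = partner (closer p)" for p
  have im: "closer ` {1..n} = C"
  proof -
    have "(\<lambda>p. p - 1) ` {1..n} = {..<n}"
    proof (intro equalityI subsetI)
      fix x assume "x \<in> {..<n}"
      then show "x \<in> (\<lambda>p. p - 1) ` {1..n}" by (intro image_eqI[of _ _ "x + 1"]) auto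
    qed auto
    then have "closer ` {1..n} = h ` {..<n}" unfolding closer_def by (metis image_image)
    then show ?thesis using h(1) by (simp add: bij_betw_def)
  qed
  then have imo: "opener ` {1..n} = partner ` C" unfolding opener_def by (metis image_image)
  have closerC: "closer p \<in> C" if "p \<in> {1..n}" for p using im that by blast
  have mono: "closer p < closer q" if "p \<in> {1..n}" "q \<in> {1..n}" "p < q" for p q
    unfolding closer_def by (rule strict_mono_onD[OF h(2)]) (use that in auto)
  have mono_iff: "closer p < closer q \<longleftrightarrow> p < q" if "p \<in> {1..n}" "q \<in> {1..n}" for p q
    using mono[of p q] mono[of q p] that by (cases p q rule: linorder_cases) auto
  obtain v where v: "\<And>p. v p \<le> p - 1" "\<And>p. n < p \<Longrightarrow> v p = 0"
    and oc: "\<And>p. p \<in> {1..n} \<Longrightarrow> opener p = opn n v p \<and> closer p = cls n v p"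
  proof (rule arcs_eq_seq_matching[of n closer opener])
    show "inj_on opener {1..n}"
    proof (rule inj_onI)
      fix p q assume pq: "p \<in> {1..n}" "q \<in> {1..n}" "opener p = opener q"
      then have "closer p = closer q" using inj closerC unfolding opener_def by (auto dest: inj_onD)
      then show "p = q" using mono_iff[of p q] mono_iff[of q p] pq by (cases p q rule: linorder_cases) auto
    qed
    show "opener ` {1..n} \<union> closer ` {1..n} = {1..2 * n}" using im imo cover by simp
    show "opener ` {1..n} \<inter> closer ` {1..n} = {}" using im imo disj by simp
    show "opener p < closer p" if "p \<in> {1..n}" for p
      using C[OF closerC[OF that]] by (simp add: opener_def)
    \<comment> \<open>With closers in the opposite order the two adjacent openers would form a type
      I pair.\<close>
    show "p < q" if pq: "p \<in> {1..n}" "q \<in> {1..n}" "opener q = opener p + 1" for p q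
    proof -
      have "{opener p, closer p} \<in> M" "{opener p + 1, closer q} \<in> M" "opener p + 1 < closer q"
        using C[OF closerC[OF pq(1)]] C[OF closerC[OF pq(2)]] pq(3) by (auto simp: opener_def)
      then have "\<not> closer q < closer p" using nI unfolding type_I_def by blast
      moreover have "p \<noteq> q" using pq(3) by auto
      ultimately show ?thesis using mono_iff[OF pq(2,1)] by simp
    qed
  qed (use mono in auto)
  have "M = (\<lambda>p. {opener p, closer p}) ` {1..n}"
  proof (intro equalityI subsetI)
    fix B assume B: "B \<in> M"
    then obtain x y where xy: "B = {x, y}" "x < y" by (rule is_matching_arc_form[OF m])
    then have "y \<in> C" using B by (auto simp: C_def)
    moreover from this obtain p where "p \<in> {1..n}" "y = closer p" using im by blast
    moreover have "partner y = x" using B xy partner by simp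
    ultimately show "B \<in> (\<lambda>p. {opener p, closer p}) ` {1..n}" using xy by (auto simp: opener_def)
  next
    fix B assume "B \<in> (\<lambda>p. {opener p, closer p}) ` {1..n}"
    then show "B \<in> M" using C closerC by (auto simp: opener_def)
  qed
  also have "\<dots> = seq_matching n v" unfolding seq_matching_def using oc by (intro image_cong) auto
  finally have Mv: "M = seq_matching n v" .
  have "v \<in> fishburn_seqs n"
    using v nII seq_matching_type_II_iff[OF v(1), of n] unfolding fishburn_seqs_def Mv by blast
  then show ?thesis using that Mv by blast
qed

lemma bij_betw_seq_matching: "bij_betw (seq_matching n) (fishburn_seqs n) (stoimenow_matchings n)"
  unfolding bij_betw_def
proof (intro conjI equalityI subsetI)
  fix M assume "M \<in> stoimenow_matchings n"
  then obtain v where "v \<in> fishburn_seqs n" "M = seq_matching n v" by (rule stoimenow_eq_seq_matching)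
  then show "M \<in> seq_matching n ` fishburn_seqs n" by blast
qed (use inj_on_seq_matching seq_matching_stoimenow in blast)+

section \<open>Occurrences of patterns\<close>

text \<open>An occurrence is an increasing embedding of positions. The half-open window from
  \<open>l\<close> to \<open>h\<close> lets an occurrence of a direct sum be cut into occurrences in
  two adjoining windows.\<close>

definition occurs :: "nat set set \<Rightarrow> nat \<Rightarrow> nat set set \<Rightarrow> nat \<Rightarrow> nat \<Rightarrow> bool" where
  "occurs M m P l h \<longleftrightarrow> (\<exists>s. strict_mono_on {1..2 * m} s \<and> (\<forall>B\<in>P. s ` B \<in> M) \<and>
     (\<forall>x\<in>{1..2 * m}. l \<le> s x \<and> s x < h))"

lemma is_matchingD:
  assumes "is_matching n M"
  shows "\<Union>M = {1..2 * n}" "B \<in> M \<Longrightarrow> B \<subseteq> {1..2 * n}" "B \<in> M \<Longrightarrow> card B = 2"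
    "B \<in> M \<Longrightarrow> B' \<in> M \<Longrightarrow> B \<noteq> B' \<Longrightarrow> B \<inter> B' = {}"
proof -
  show U: "\<Union>M = {1..2 * n}" using assms by (simp add: is_matching_def partition_on_def)
  then show "B \<in> M \<Longrightarrow> B \<subseteq> {1..2 * n}" by blast
  show "B \<in> M \<Longrightarrow> card B = 2" using assms by (simp add: is_matching_def)
  show "B \<in> M \<Longrightarrow> B' \<in> M \<Longrightarrow> B \<noteq> B' \<Longrightarrow> B \<inter> B' = {}"
    using assms by (auto simp: is_matching_def partition_on_def dest: disjointD)
qed

lemma is_matchingI:
  assumes "\<Union>M = {1..2 * n}" "\<And>B. B \<in> M \<Longrightarrow> card B = 2"
    "\<And>B B'. B \<in> M \<Longrightarrow> B' \<in> M \<Longrightarrow> B \<noteq> B' \<Longrightarrow> B \<inter> B' = {}"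
  shows "is_matching n M"
proof -
  have "{} \<notin> M" using assms(2)[of "{}"] by auto
  moreover have "disjoint M" by (rule disjointI) (rule assms(3))
  ultimately show ?thesis unfolding is_matching_def partition_on_def using assms(1,2) by blast
qed

lemma is_matching_card:
  assumes "is_matching n M"
  shows "card M = n"
proof -
  note D = is_matchingD[OF assms]
  have fin: "finite B" if "B \<in> M" for B using finite_subset[OF D(2)[OF that]] by simp
  have "card (\<Union>M) = sum card M"
    using fin D(4) by (intro card_Union_disjoint) (auto simp: pairwise_def disjnt_def)
  also have "\<dots> = 2 * card M" using D(3) by simp
  finally show ?thesis using D(1) by simp
qed

text \<open>Ranking the endpoints of the chosen arcs and embedding the pattern positions are
  mutually inverse.\<close>

lemma contains_pattern_iff_occurs:
  assumes M: "is_matching n M" and P: "is_matching m P"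
  shows "contains_pattern M P \<longleftrightarrow> occurs M m P 0 (2 * n + 1)"
proof
  assume "contains_pattern M P"
  then obtain S where S: "S \<subseteq> M" "relabel S = P" unfolding contains_pattern_def by blast
  define U where "U = \<Union>S"
  have U: "U \<subseteq> {1..2 * n}" using S(1) is_matchingD(1)[OF M] by (auto simp: U_def)
  then have finU: "finite U" by (rule finite_subset) simp
  define r where "r x = card {y \<in> U. y \<le> x}" for x
  have relab: "P = (\<lambda>B. r ` B) ` S" using S(2) by (simp add: relabel_def r_def U_def)
  have r_less: "r x < r y" if "x < y" "y \<in> U" for x y
  proof -
    have "y \<in> {z \<in> U. z \<le> y}" "y \<notin> {z \<in> U. z \<le> x}" using that by auto
    moreover have "{z \<in> U. z \<le> x} \<subseteq> {z \<in> U. z \<le> y}" using that by auto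
    ultimately have "{z \<in> U. z \<le> x} \<subset> {z \<in> U. z \<le> y}" by blast
    then show ?thesis unfolding r_def using finU by (intro psubset_card_mono) auto
  qed
  have inj: "inj_on r U"
  proof (rule inj_onI)
    fix x y assume "x \<in> U" "y \<in> U" "r x = r y"
    then show "x = y" using r_less[of x y] r_less[of y x] by (cases x y rule: linorder_cases) auto
  qed
  have rU: "r ` U = {1..2 * m}"
    using is_matchingD(1)[OF P] unfolding relab U_def by blast
  define s where "s = inv_into U r"
  have s: "s x \<in> U \<and> r (s x) = x" if "x \<in> {1..2 * m}" for x
    using that unfolding rU[symmetric] s_def by (auto intro: inv_into_into f_inv_into_f)
  have "strict_mono_on {1..2 * m} s"
  proof (rule strict_mono_onI)
    fix x y assume "x \<in> {1..2 * m}" "y \<in> {1..2 * m}" "x < y"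
    then show "s x < s y" using s[of x] s[of y] r_less[of "s y" "s x"]
      by (cases "s x" "s y" rule: linorder_cases) auto
  qed
  moreover have "s ` B \<in> M" if B: "B \<in> P" for B
  proof -
    obtain B' where "B' \<in> S" "B = r ` B'" using B relab by blast
    moreover have "s ` r ` B' = B'" if "B' \<in> S" for B'
      unfolding s_def using inj that by (intro inv_into_image_cancel) (auto simp: U_def)
    ultimately show ?thesis using S(1) by auto
  qed
  moreover have "0 \<le> s x \<and> s x < 2 * n + 1" if "x \<in> {1..2 * m}" for x
    using s[OF that] U by auto
  ultimately show "occurs M m P 0 (2 * n + 1)" unfolding occurs_def by blast
next
  assume "occurs M m P 0 (2 * n + 1)"
  then obtain s where s: "strict_mono_on {1..2 * m} s" "\<And>B. B \<in> P \<Longrightarrow> s ` B \<in> M"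
    unfolding occurs_def by blast
  define S where "S = (\<lambda>B. s ` B) ` P"
  have U: "\<Union>S = s ` {1..2 * m}" unfolding S_def using is_matchingD(1)[OF P] by blast
  have le_iff: "s y \<le> s x \<longleftrightarrow> y \<le> x" if "x \<in> {1..2 * m}" "y \<in> {1..2 * m}" for x y
    using strict_mono_onD[OF s(1) that] strict_mono_onD[OF s(1) that(2,1)]
    by (cases x y rule: linorder_cases) auto
  have rank: "card {y \<in> \<Union>S. y \<le> s x} = x" if x: "x \<in> {1..2 * m}" for x
  proof -
    have "{y \<in> \<Union>S. y \<le> s x} = s ` {1..x}"
      unfolding U using x le_iff[OF x] by auto
    moreover have "inj_on s {1..x}"
    proof (rule inj_onI)
      fix a b assume "a \<in> {1..x}" "b \<in> {1..x}" "s a = s b"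
      then show "a = b" using le_iff[of a b] le_iff[of b a] x by (simp add: le_antisym)
    qed
    ultimately show ?thesis by (simp add: card_image)
  qed
  have "(\<lambda>x. card {y \<in> \<Union>S. y \<le> x}) ` s ` B = B" if "B \<in> P" for B
  proof -
    have "B \<subseteq> {1..2 * m}" by (rule is_matchingD(2)[OF P that])
    then have "card {y \<in> \<Union>S. y \<le> s x} = x" if "x \<in> B" for x using rank that by blast
    then show ?thesis by (simp add: image_image)
  qed
  then have "relabel S = P" unfolding relabel_def by (simp add: S_def image_image)
  moreover have "S \<subseteq> M" using s(2) by (auto simp: S_def)
  ultimately show "contains_pattern M P" unfolding contains_pattern_def by blast
qed

lemma is_matching_msum:
  assumes P: "is_matching p P" and Q: "is_matching q Q"
  shows "is_matching (p + q) (msum P Q)"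
proof (rule is_matchingI)
  note DP = is_matchingD[OF P] and DQ = is_matchingD[OF Q]
  note ms = msum_def is_matching_card[OF P]
  have sh: "(\<lambda>x. x + 2 * p) ` {1..2 * q} = {2 * p + 1..2 * (p + q)}"
    using image_add_atLeastAtMost'[of "2 * p" 1 "2 * q"] by (simp add: add_ac algebra_simps)
  have "\<Union>(msum P Q) = {1..2 * p} \<union> (\<lambda>x. x + 2 * p) ` {1..2 * q}"
    unfolding ms DP(1)[symmetric] DQ(1)[symmetric] by blast
  also have "\<dots> = {1..2 * (p + q)}" unfolding sh by auto
  finally show "\<Union>(msum P Q) = {1..2 * (p + q)}" .
  show "card B = 2" if "B \<in> msum P Q" for B
    using that DP(3) DQ(3) unfolding ms by (auto simp: card_image)
  show "B \<inter> B' = {}" if BB: "B \<in> msum P Q" "B' \<in> msum P Q" "B \<noteq> B'" for B B'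
  proof -
    have PQ: "B \<inter> (\<lambda>x. x + 2 * p) ` B' = {}" if "B \<in> P" "B' \<in> Q" for B B'
    proof -
      have "B \<subseteq> {1..2 * p}" "(\<lambda>x. x + 2 * p) ` B' \<subseteq> {2 * p + 1..2 * (p + q)}"
        using DP(2)[OF that(1)] DQ(2)[OF that(2)] sh by blast+
      then show ?thesis by fastforce
    qed
    have QQ: "(\<lambda>x. x + 2 * p) ` B \<inter> (\<lambda>x. x + 2 * p) ` B' = {}"
      if "B \<in> Q" "B' \<in> Q" "B \<noteq> B'" for B B'
      using DQ(4)[OF that] by auto
    consider "B \<in> P" "B' \<in> P"
      | C where "B \<in> P" "C \<in> Q" "B' = (\<lambda>x. x + 2 * p) ` C"
      | C where "B' \<in> P" "C \<in> Q" "B = (\<lambda>x. x + 2 * p) ` C"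
      | C C' where "C \<in> Q" "C' \<in> Q" "B = (\<lambda>x. x + 2 * p) ` C" "B' = (\<lambda>x. x + 2 * p) ` C'"
      using BB(1,2) unfolding ms by blast
    then show ?thesis
    proof cases
      case 1 then show ?thesis using DP(4) BB(3) by blast
    next
      case 2 then show ?thesis using PQ by simp
    next
      case 3 then show ?thesis using PQ by (simp add: Int_commute)
    next
      case 4 then show ?thesis using QQ[of C C'] BB(3) by blast
    qed
  qed
qed

lemma is_matching_single_arc: "is_matching 1 single_arc"
  unfolding single_arc_def by (rule is_matchingI) (auto simp: numeral_2_eq_2)

lemma is_matching_chain: "is_matching m (chain_matching m)"
  using is_chain_chain_matching by (simp add: is_chain_def)

lemma occurs_msum:
  assumes P: "is_matching p P" and Q: "is_matching q Q" and lh: "l \<le> h"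
  shows "occurs M (p + q) (msum P Q) l h \<longleftrightarrow>
    (\<exists>x. l \<le> x \<and> x \<le> h \<and> occurs M p P l x \<and> occurs M q Q x h)"
proof
  assume "occurs M (p + q) (msum P Q) l h"
  then obtain s where s: "strict_mono_on {1..2 * (p + q)} s"
    and sM: "\<And>B. B \<in> msum P Q \<Longrightarrow> s ` B \<in> M"
    and sb: "\<And>x. x \<in> {1..2 * (p + q)} \<Longrightarrow> l \<le> s x \<and> s x < h"
    unfolding occurs_def by blast
  note less = strict_mono_onD[OF s]
  \<comment> \<open>The cut is placed directly after the last position of the first summand; an
    empty summand has none, and the cut is then \<open>l\<close>.\<close>
  define x where "x = (if p = 0 then l else s (2 * p) + 1)"
  have x: "l \<le> x \<and> x \<le> h" using sb[of "2 * p"] lh by (auto simp: x_def)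
  have "occurs M p P l x" unfolding occurs_def
  proof (intro exI conjI ballI)
    show "strict_mono_on {1..2 * p} s" using less by (auto intro!: strict_mono_onI)
    show "s ` B \<in> M" if "B \<in> P" for B using sM that by (simp add: msum_def)
    fix y assume y: "y \<in> {1..2 * p}"
    then show "l \<le> s y" using sb[of y] by simp
    have "s y \<le> s (2 * p)" using less[of y "2 * p"] y by (cases "y = 2 * p") auto
    then show "s y < x" using y by (auto simp: x_def)
  qed
  moreover have "occurs M q Q x h" unfolding occurs_def
  proof (intro exI conjI ballI)
    show "strict_mono_on {1..2 * q} (\<lambda>y. s (y + 2 * p))" using less by (auto intro!: strict_mono_onI)
    show "(\<lambda>y. s (y + 2 * p)) ` B \<in> M" if "B \<in> Q" for B
      using sM[of "(\<lambda>y. y + 2 * p) ` B"] that by (simp add: msum_def is_matching_card[OF P] image_image)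
    fix y assume y: "y \<in> {1..2 * q}"
    then show "s (y + 2 * p) < h" using sb[of "y + 2 * p"] by simp
    show "x \<le> s (y + 2 * p)"
      using y sb[of "y + 2 * p"] less[of "2 * p" "y + 2 * p"] by (auto simp: x_def Suc_le_eq)
  qed
  ultimately show "\<exists>x. l \<le> x \<and> x \<le> h \<and> occurs M p P l x \<and> occurs M q Q x h" using x by blast
next
  assume "\<exists>x. l \<le> x \<and> x \<le> h \<and> occurs M p P l x \<and> occurs M q Q x h"
  then obtain x s1 s2 where x: "l \<le> x" "x \<le> h"
    and s1: "strict_mono_on {1..2 * p} s1" "\<And>B. B \<in> P \<Longrightarrow> s1 ` B \<in> M"
      "\<And>y. y \<in> {1..2 * p} \<Longrightarrow> l \<le> s1 y \<and> s1 y < x"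
    and s2: "strict_mono_on {1..2 * q} s2" "\<And>B. B \<in> Q \<Longrightarrow> s2 ` B \<in> M"
      "\<And>y. y \<in> {1..2 * q} \<Longrightarrow> x \<le> s2 y \<and> s2 y < h"
    unfolding occurs_def by blast
  define s where "s y = (if y \<le> 2 * p then s1 y else s2 (y - 2 * p))" for y
  show "occurs M (p + q) (msum P Q) l h" unfolding occurs_def
  proof (intro exI conjI ballI)
    show "strict_mono_on {1..2 * (p + q)} s"
    proof (rule strict_mono_onI)
      fix a b assume ab: "a \<in> {1..2 * (p + q)}" "b \<in> {1..2 * (p + q)}" "a < b"
      consider "b \<le> 2 * p" | "a \<le> 2 * p" "2 * p < b" | "2 * p < a" using ab by linarith
      then show "s a < s b"
      proof cases
        case 1 then show ?thesis using strict_mono_onD[OF s1(1), of a b] ab by (simp add: s_def)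
      next
        case 2 then show ?thesis using s1(3)[of a] s2(3)[of "b - 2 * p"] ab by (fastforce simp: s_def)
      next
        case 3
        then show ?thesis
          using strict_mono_onD[OF s2(1), of "a - 2 * p" "b - 2 * p"] ab by (fastforce simp: s_def)
      qed
    qed
    show "s ` B \<in> M" if B: "B \<in> msum P Q" for B
    proof (cases "B \<in> P")
      case True
      then have "s ` B = s1 ` B" using is_matchingD(2)[OF P True] by (intro image_cong) (auto simp: s_def)
      then show ?thesis using s1(2)[OF True] by simp
    next
      case False
      then obtain C where C: "C \<in> Q" "B = (\<lambda>y. y + 2 * p) ` C"
        using B unfolding msum_def is_matching_card[OF P] by blast
      have "s ` B = (\<lambda>y. s (y + 2 * p)) ` C" using C(2) by (simp add: image_image)
      also have "\<dots> = s2 ` C"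
        using is_matchingD(2)[OF Q C(1)] by (intro image_cong) (auto simp: s_def)
      finally show ?thesis using s2(2)[OF C(1)] by simp
    qed
    fix y assume y: "y \<in> {1..2 * (p + q)}"
    have "l \<le> s y \<and> s y < h"
    proof (cases "y \<le> 2 * p")
      case True
      then show ?thesis using y x s1(3)[of y] by (auto simp: s_def)
    next
      case False
      then have "y - 2 * p \<in> {1..2 * q}" using y by auto
      then show ?thesis using False x s2(3) by (fastforce simp: s_def)
    qed
    then show "l \<le> s y" "s y < h" by simp_all
  qed
qed

section \<open>Chains in terms of closer indices\<close>

text \<open>The bound \<open>x\<close> restricts the second arc. For the first arc it is its own
  \<open>v p\<close>, comparing openers; afterwards it is the closer index of the preceding arc,
  which must lie left of the opener after next. At the last arc the same bound becomes
  \<open>x < p\<close>, the order of the last two closers. The predicate \<open>G\<close> restricts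
  the last closer.\<close>

fun reach :: "nat \<Rightarrow> (nat \<Rightarrow> nat) \<Rightarrow> (nat \<Rightarrow> bool) \<Rightarrow> nat \<Rightarrow> nat \<Rightarrow> nat \<Rightarrow> bool" where
  "reach n v G 0 x p \<longleftrightarrow> x < p \<and> G p"
| "reach n v G (Suc t) x p \<longleftrightarrow> (\<exists>q\<in>{1..n}. x \<le> v q \<and> v q < p \<and> reach n v G t p q)"

lemma reach_mono:
  assumes "\<And>q. q \<in> {1..n} \<Longrightarrow> G q \<Longrightarrow> G' q" "p \<in> {1..n}" "reach n v G t x p"
  shows "reach n v G' t x p"
  using assms(2,3)
proof (induction t arbitrary: x p)
  case (Suc t)
  then obtain q where "q \<in> {1..n}" "x \<le> v q" "v q < p" "reach n v G t p q" by auto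
  then show ?case using Suc.IH[of q p] by auto
qed (use assms(1) in auto)

lemma reach_end:
  assumes "p \<in> {1..n}" "reach n v G t x p"
  obtains q where "q \<in> {1..n}" "G q" "p \<le> q"
proof -
  \<comment> \<open>The extra claim \<open>x < q\<close> carries the induction: in the recursive
    call \<open>p\<close> takes the place of \<open>x\<close>, which yields
    \<open>p < q\<close>.\<close>
  have "\<exists>q\<in>{1..n}. G q \<and> p \<le> q \<and> x < q"
    using assms
  proof (induction t arbitrary: x p)
    case (Suc t)
    then obtain r where r: "r \<in> {1..n}" "x \<le> v r" "v r < p" "reach n v G t p r" by auto
    then show ?case using Suc.IH[OF r(1,4)] by fastforce
  qed auto
  then show ?thesis using that by blast
qed

text \<open>A positive \<open>x\<close> excludes both the phantom index \<open>0\<close> and the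
  \<open>0\<close> inserted into the maximum. The recursion keeps the bound positive, because the
  new bound \<open>p\<close> exceeds \<open>v q\<close>.\<close>

lemma reach_iff_le_peak:
  assumes "v 0 = 0" "1 \<le> x"
  shows "reach n v (\<lambda>q. q \<le> N) t x p \<longleftrightarrow> x \<le> peak n N v t p"
  using assms(2)
proof (induction t arbitrary: x p)
  case 0
  then show ?case by auto
next
  case (Suc t)
  have "q \<in> {1..n} \<and> x \<le> v q \<and> v q < p \<and> reach n v (\<lambda>q. q \<le> N) t p q \<longleftrightarrow>
      q \<le> n \<and> x \<le> v q \<and> v q < p \<and> p \<le> peak n N v t q" for q
    using Suc.IH[of p q] Suc.prems assms(1) by (cases "q = 0") auto
  then show ?case unfolding le_peak_Suc_iff[OF Suc.prems] reach.simps by blast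
qed

text \<open>\<open>f 0, \<dots>, f t\<close> are the closer indices of the arcs of a chain of \<open>t + 1\<close> arcs.\<close>

lemma reach_iff_sequence:
  "reach n v G t x p \<longleftrightarrow> (\<exists>f. f 0 = p \<and> (\<forall>i. 1 \<le> i \<and> i \<le> t \<longrightarrow> f i \<in> {1..n}) \<and>
     (t = 0 \<longrightarrow> x < p) \<and> (1 \<le> t \<longrightarrow> x \<le> v (f 1) \<and> f (t - 1) < f t) \<and>
     (\<forall>i<t. v (f (i + 1)) < f i) \<and> (\<forall>i. i + 2 \<le> t \<longrightarrow> f i \<le> v (f (i + 2))) \<and> G (f t))"
proof (induction t arbitrary: x p)
  case 0
  then show ?case by auto
next
  case (Suc t)
  show ?case
  proof
    assume "reach n v G (Suc t) x p"
    then obtain q where q: "q \<in> {1..n}" "x \<le> v q" "v q < p" "reach n v G t p q" by auto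
    then obtain f where f: "f 0 = q" "\<forall>i. 1 \<le> i \<and> i \<le> t \<longrightarrow> f i \<in> {1..n}"
      "t = 0 \<longrightarrow> p < q" "1 \<le> t \<longrightarrow> p \<le> v (f 1) \<and> f (t - 1) < f t"
      "\<forall>i<t. v (f (i + 1)) < f i" "\<forall>i. i + 2 \<le> t \<longrightarrow> f i \<le> v (f (i + 2))" "G (f t)"
      unfolding Suc.IH by blast
    define g where "g = case_nat p f"
    have g: "g 0 = p" "\<And>i. g (Suc i) = f i" by (auto simp: g_def)
    have "g i \<in> {1..n}" if "1 \<le> i" "i \<le> Suc t" for i
      using that f(1,2) q(1) by (cases i; cases "i - 1") (auto simp: g)
    moreover have "g (Suc t - 1) < g (Suc t)" using f(1,3,4) by (cases t) (auto simp: g)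
    moreover have "v (g (i + 1)) < g i" if "i < Suc t" for i
      using that f(1,5) q(3) by (cases i) (auto simp: g)
    moreover have "g i \<le> v (g (i + 2))" if "i + 2 \<le> Suc t" for i
      using that f(4,6) by (cases i) (auto simp: g)
    ultimately show "\<exists>f. f 0 = p \<and> (\<forall>i. 1 \<le> i \<and> i \<le> Suc t \<longrightarrow> f i \<in> {1..n}) \<and>
     (Suc t = 0 \<longrightarrow> x < p) \<and> (1 \<le> Suc t \<longrightarrow> x \<le> v (f 1) \<and> f (Suc t - 1) < f (Suc t)) \<and>
     (\<forall>i<Suc t. v (f (i + 1)) < f i) \<and> (\<forall>i. i + 2 \<le> Suc t \<longrightarrow> f i \<le> v (f (i + 2))) \<and> G (f (Suc t))"
      using g f(1,7) q(2) by (intro exI[of _ g]) auto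
  next
    assume "\<exists>f. f 0 = p \<and> (\<forall>i. 1 \<le> i \<and> i \<le> Suc t \<longrightarrow> f i \<in> {1..n}) \<and>
     (Suc t = 0 \<longrightarrow> x < p) \<and> (1 \<le> Suc t \<longrightarrow> x \<le> v (f 1) \<and> f (Suc t - 1) < f (Suc t)) \<and>
     (\<forall>i<Suc t. v (f (i + 1)) < f i) \<and> (\<forall>i. i + 2 \<le> Suc t \<longrightarrow> f i \<le> v (f (i + 2))) \<and> G (f (Suc t))"
    then obtain f where f: "f 0 = p" "\<forall>i. 1 \<le> i \<and> i \<le> Suc t \<longrightarrow> f i \<in> {1..n}"
      "x \<le> v (f 1)" "f t < f (Suc t)"
      "\<forall>i<Suc t. v (f (i + 1)) < f i" "\<forall>i. i + 2 \<le> Suc t \<longrightarrow> f i \<le> v (f (i + 2))" "G (f (Suc t))"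
      by auto
    have "reach n v G t p (f 1)" unfolding Suc.IH
    proof (rule exI[of _ "\<lambda>i. f (Suc i)"], intro conjI allI impI)
      show "p \<le> v (f (Suc 1))" if "1 \<le> t" using f(6)[rule_format, of 0] f(1) that by (simp add: numeral_2_eq_2)
      show "f (Suc i) \<le> v (f (Suc (i + 2)))" if "i + 2 \<le> t" for i
        using f(6)[rule_format, of "Suc i"] that by simp
      show "v (f (Suc (i + 1))) < f (Suc i)" if "i < t" for i
        using f(5)[rule_format, of "Suc i"] that by simp
    qed (use f in auto)
    moreover have "f 1 \<in> {1..n}" "v (f 1) < p" using f(1,2) f(5)[rule_format, of 0] by auto
    ultimately show "reach n v G (Suc t) x p" using f(3) by auto
  qed
qed

lemma strict_mono_on_interval_steps:
  fixes s :: "nat \<Rightarrow> nat"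
  assumes "\<And>j. 1 \<le> j \<Longrightarrow> j < N \<Longrightarrow> s j < s (j + 1)"
  shows "strict_mono_on {1..N} s"
proof (rule strict_mono_onI)
  fix a b assume "a \<in> {1..N}" "b \<in> {1..N}" "a < b"
  then have "1 \<le> a" "Suc a \<le> b" "b \<le> N" by auto
  from this(2,1,3) show "s a < s b"
  proof (induction b rule: dec_induct)
    case base then show ?case using assms[of a] by simp
  next
    case (step b) then show ?case using assms[of b] by simp
  qed
qed

text \<open>Chain inequalities mostly compare an opener with a closer, where \<open>v q < p\<close>
  and \<open>p \<le> v q\<close> express the order of positions. Only the first two openers and the
  last two closers are compared with each other, which causes the boundary cases.\<close>

lemma occurs_chain:
  assumes v: "\<And>p. v p \<le> p - 1"
  shows "occurs (seq_matching n v) (Suc t) (chain_matching (Suc t)) l h \<longleftrightarrow>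
    (\<exists>p\<in>{1..n}. l \<le> opn n v p \<and> reach n v (\<lambda>q. cls n v q < h) t (v p) p)"
    (is "?L \<longleftrightarrow> ?R")
proof
  let ?a = "\<lambda>i. chain_opener (i + 1)" and ?b = "\<lambda>i. chain_closer (Suc t) (i + 1)"
  assume ?L
  then obtain s where s: "strict_mono_on {1..2 * Suc t} s"
    "\<And>B. B \<in> chain_matching (Suc t) \<Longrightarrow> s ` B \<in> seq_matching n v"
    "\<And>x. x \<in> {1..2 * Suc t} \<Longrightarrow> l \<le> s x \<and> s x < h"
    unfolding occurs_def by blast
  have "\<exists>p. p \<in> {1..n} \<and> s (?a i) = opn n v p \<and> s (?b i) = cls n v p" if "i \<le> t" for i
  proof -
    have "{?a i, ?b i} \<in> chain_matching (Suc t)"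
      unfolding chain_matching_eq using that by force
    then have "{s (?a i), s (?b i)} \<in> seq_matching n v" using s(2) by fastforce
    moreover have "s (?a i) < s (?b i)"
      using that by (intro strict_mono_onD[OF s(1)]) (auto simp: chain_opener_def chain_closer_def)
    ultimately show ?thesis using seq_matching_arcs[of v "s (?a i)" "s (?b i)" n, OF v] by blast
  qed
  then obtain f where f: "\<And>i. i \<le> t \<Longrightarrow> f i \<in> {1..n}"
    "\<And>i. i \<le> t \<Longrightarrow> opn n v (f i) = s (?a i)" "\<And>i. i \<le> t \<Longrightarrow> cls n v (f i) = s (?b i)"
    by metis
  have less: "s x < s y" if "1 \<le> x" "x < y" "y \<le> 2 * Suc t" for x y
    using that by (intro strict_mono_onD[OF s(1)]) auto
  have "reach n v (\<lambda>q. cls n v q < h) t (v (f 0)) (f 0)"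
    unfolding reach_iff_sequence
  proof (intro exI[of _ f] conjI allI impI)
    show "v (f 0) < f 0" using v[of "f 0"] f(1)[of 0] by auto
    show "v (f 0) \<le> v (f 1)" if "1 \<le> t"
    proof -
      have "opn n v (f 0) < opn n v (f 1)"
        using f(2)[of 0] f(2)[of 1] less[of "?a 0" "?a 1"] that by (simp add: chain_opener_def)
      then show ?thesis using opn_less_opn_iff[of "f 0" n "f 1" v] f(1) that by auto
    qed
    show "f (t - 1) < f t" if "1 \<le> t"
    proof -
      have "cls n v (f (t - 1)) < cls n v (f t)"
        using f(3)[of "t - 1"] f(3)[of t] less[of "?b (t - 1)" "?b t"] that
        by (simp add: chain_closer_def)
      then show ?thesis by (simp add: cls_less_cls_iff)
    qed
    show "v (f (i + 1)) < f i" if "i < t" for i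
    proof -
      have "opn n v (f (i + 1)) < cls n v (f i)"
        using f(2)[of "i + 1"] f(3)[of i] less[of "?a (i + 1)" "?b i"] that
        by (simp add: chain_closer_def chain_opener_def)
      then show ?thesis using opn_less_cls_iff[of "f (i + 1)" n v "f i"] f(1) that by simp
    qed
    show "f i \<le> v (f (i + 2))" if "i + 2 \<le> t" for i
    proof -
      have "cls n v (f i) < opn n v (f (i + 2))"
        using f(2)[of "i + 2"] f(3)[of i] less[of "?b i" "?a (i + 2)"] that
        by (simp add: chain_closer_def chain_opener_def)
      then show ?thesis using cls_less_opn_iff[of "f (i + 2)" n v "f i"] f(1) that by simp
    qed
    show "cls n v (f t) < h" using f(3)[of t] s(3)[of "?b t"] by (simp add: chain_closer_def)
  qed (use f in auto)
  moreover have "l \<le> opn n v (f 0)" using f(2)[of 0] s(3)[of "?a 0"] by (simp add: chain_opener_def)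
  ultimately show ?R using f(1)[of 0] by blast
next
  assume ?R
  then obtain f where f0: "f 0 \<in> {1..n}" "l \<le> opn n v (f 0)"
    and f: "\<forall>i. 1 \<le> i \<and> i \<le> t \<longrightarrow> f i \<in> {1..n}" "1 \<le> t \<longrightarrow> v (f 0) \<le> v (f 1) \<and> f (t - 1) < f t"
      "\<forall>i<t. v (f (i + 1)) < f i" "\<forall>i. i + 2 \<le> t \<longrightarrow> f i \<le> v (f (i + 2))" "cls n v (f t) < h"
    unfolding reach_iff_sequence by blast
  have fin: "f i \<in> {1..n}" if "i \<le> t" for i using f0 f(1) that by (cases i) auto
  \<comment> \<open>The positions of a chain alternate: for an inner position, \<open>2 * i\<close>
    is the opener of \<open>f i\<close> and \<open>2 * i + 1\<close> the closer of
    \<open>f (i - 1)\<close>.\<close>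
  define s where "s j = (if j = 1 then opn n v (f 0) else if j = 2 * Suc t then cls n v (f t)
      else if even j then opn n v (f (j div 2)) else cls n v (f (j div 2 - 1)))" for j
  have step: "s j < s (j + 1)" if j: "1 \<le> j" "j < 2 * Suc t" for j
  proof (cases "t = 0")
    case True
    then show ?thesis using j opn_less_cls[of v "f 0" "f 0" n] v[of "f 0"] f0 by (auto simp: s_def)
  next
    case t: False
    show ?thesis
    proof (cases "even j")
      case True
      then obtain i where i: "j = 2 * i" by (elim evenE)
      with j have "1 \<le> i" "i \<le> t" by auto
      then obtain i' where i': "i = Suc i'" "i' < t" by (cases i) auto
      have "opn n v (f i) < cls n v (f i')" using f(3) i' by (auto intro: opn_less_cls)
      then show ?thesis using i i' j by (auto simp: s_def)
    next
      case False
      then obtain i where i: "j = 2 * i + 1" by (elim oddE)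
      with j have it: "i \<le> t" by auto
      consider "i = 0" | "i = t" "0 < i" | i' where "i = Suc i'" "i < t"
        using it by (metis gr0_conv_Suc le_less not_gr_zero)
      then show ?thesis
      proof cases
        case 1
        \<comment> \<open>Needed if the first two openers share a gap. For two arcs it is the order
          of the last closers; otherwise the opener of the third arc lies between the first two
          closers.\<close>
        have "f 0 < f 1"
        proof (cases "t = 1")
          case False
          then have "f 0 \<le> v (f 2)" "v (f 2) < f 1" using t f(3)[rule_format, of 1] f(4)[rule_format, of 0]
            by (auto simp: numeral_2_eq_2)
          then show ?thesis by simp
        qed (use f(2) in auto)
        moreover have "v (f 0) \<le> v (f 1)" "f 1 \<in> {1..n}" using t f(2) fin by auto
        ultimately have "opn n v (f 0) < opn n v (f 1)" by (intro opn_less_opn) auto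
        then show ?thesis using 1 i t by (auto simp: s_def)
      next
        case 2
        have "cls n v (f (t - 1)) < cls n v (f t)" using t f(2) by (auto intro: cls_less_cls)
        then show ?thesis using 2 i by (auto simp: s_def)
      next
        case 3
        have "cls n v (f i') < opn n v (f (i' + 2))"
          using 3 f(4) fin by (intro cls_less_opn) auto
        then show ?thesis using 3 i by (auto simp: s_def)
      qed
    qed
  qed
  have mono: "strict_mono_on {1..2 * Suc t} s" using step by (rule strict_mono_on_interval_steps)
  show ?L unfolding occurs_def
  proof (intro exI conjI ballI)
    show "strict_mono_on {1..2 * Suc t} s" by (rule mono)
    show "s ` B \<in> seq_matching n v" if B: "B \<in> chain_matching (Suc t)" for B
    proof -
      obtain i where i: "1 \<le> i" "i \<le> Suc t" "B = {chain_opener i, chain_closer (Suc t) i}"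
        using B unfolding chain_matching_eq by blast
      then obtain i' where i': "i = Suc i'" "i' \<le> t" by (cases i) auto
      have "s (chain_opener i) = opn n v (f i')" using i' by (cases "i' = 0") (auto simp: s_def chain_opener_def)
      moreover have "s (chain_closer (Suc t) i) = cls n v (f i')"
        using i' by (cases "i' = t") (auto simp: s_def chain_closer_def)
      ultimately show ?thesis using i(3) fin[OF i'(2)] by (auto simp: seq_matching_def)
    qed
    fix x assume x: "x \<in> {1..2 * Suc t}"
    have "s 1 \<le> s x" using strict_mono_onD[OF mono, of 1 x] x by (cases "x = 1") auto
    then show "l \<le> s x" using f0(2) by (simp add: s_def)
    have "s x \<le> s (2 * Suc t)"
      using strict_mono_onD[OF mono, of x "2 * Suc t"] x by (cases "x = 2 * Suc t") auto
    then show "s x < h" using f(5) by (simp add: s_def)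
  qed
qed

lemma chain_1: "chain_matching 1 = single_arc"
proof -
  have "chain_matching 1 = (\<lambda>i. {chain_opener i, chain_closer 1 i}) ` {1..1}"
    unfolding chain_matching_eq image_def atLeastAtMost_iff Bex_def by (simp add: conj_commute)
  then show ?thesis by (simp add: single_arc_def chain_opener_def chain_closer_def)
qed

lemma chain_0: "chain_matching 0 = {}"
  by (auto simp: chain_matching_eq)

lemma occurs_single_arc:
  assumes v: "\<And>p. v p \<le> p - 1"
  shows "occurs (seq_matching n v) 1 single_arc l h \<longleftrightarrow>
    (\<exists>p\<in>{1..n}. l \<le> opn n v p \<and> cls n v p < h)"
proof -
  have "v p < p" if "p \<in> {1..n}" for p using v[of p] that by auto
  then show ?thesis using occurs_chain[OF v, of n 0 l h] chain_1 by auto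
qed

section \<open>Avoidance as inequalities between entries and peaks\<close>

lemma opn_le_length:
  assumes "\<And>p. v p \<le> p - 1" "p \<in> {1..n}"
  shows "opn n v p < cls n v p" "cls n v p < 2 * n + 1"
proof -
  show "opn n v p < cls n v p" using assms by (intro opn_less_cls_same)
  have "card {q \<in> {1..n}. v q < p} \<le> card {1..n}" by (intro card_mono) auto
  then show "cls n v p < 2 * n + 1" using assms(2) by (auto simp: cls_def)
qed

text \<open>A chain starting at \<open>q\<close> can be preceded by an arc with closer
  \<open>p\<close> exactly if \<open>p\<close> exceeds \<open>v q\<close> but not the peak at
  \<open>q\<close>. The smallest candidate is \<open>v q + 1\<close>, so only
  \<open>v q < peak n N v t q\<close> matters.\<close>

lemma reach_peak_high:
  assumes v: "\<And>p. v p \<le> p - 1"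
  shows "(\<exists>p\<in>{1..n}. reach n v (\<lambda>q. q \<le> N) (Suc t) (v p) p) \<longleftrightarrow> (\<exists>p\<le>n. v p < peak n N v t p)"
proof
  have v0: "v 0 = 0" using v[of 0] by simp
  assume "\<exists>p\<in>{1..n}. reach n v (\<lambda>q. q \<le> N) (Suc t) (v p) p"
  then obtain p q where "p \<in> {1..n}" "q \<in> {1..n}" "v q < p" "reach n v (\<lambda>q. q \<le> N) t p q" by auto
  then have "q \<le> n" "v q < peak n N v t q" using reach_iff_le_peak[of v p n N t q, OF v0] by auto
  then show "\<exists>p\<le>n. v p < peak n N v t p" by blast
next
  have v0: "v 0 = 0" using v[of 0] by simp
  assume "\<exists>p\<le>n. v p < peak n N v t p"
  then obtain q where q: "q \<le> n" "v q < peak n N v t q" by blast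
  \<comment> \<open>The new first arc is the one whose closer comes next after the opener of
    \<open>q\<close>; the bound \<open>v p \<le> p - 1\<close> puts its opener early enough
    automatically.\<close>
  then have "q \<in> {1..n}" "v q + 1 \<in> {1..n}" using peak_le[of n N v t q] by auto
  moreover have "reach n v (\<lambda>q. q \<le> N) t (v q + 1) q"
    using q reach_iff_le_peak[of v "v q + 1" n N t q, OF v0] by simp
  moreover have "v (v q + 1) \<le> v q" using v[of "v q + 1"] by simp
  ultimately have "reach n v (\<lambda>q. q \<le> N) (Suc t) (v (v q + 1)) (v q + 1)" by auto
  then show "\<exists>p\<in>{1..n}. reach n v (\<lambda>q. q \<le> N) (Suc t) (v p) p"
    using \<open>v q + 1 \<in> {1..n}\<close> by blast
qed

lemma reach_peak_low:
  assumes v: "\<And>p. v p \<le> p - 1"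
  shows "(\<exists>p\<in>{1..n}. 1 \<le> v p \<and> reach n v (\<lambda>q. q \<le> N) t (v p) p) \<longleftrightarrow>
    (\<exists>p\<le>n. v p \<noteq> 0 \<and> v p \<le> peak n N v t p)"
proof -
  have v0: "v 0 = 0" using v[of 0] by simp
  have "p \<in> {1..n} \<and> 1 \<le> v p \<and> reach n v (\<lambda>q. q \<le> N) t (v p) p \<longleftrightarrow>
      p \<le> n \<and> v p \<noteq> 0 \<and> v p \<le> peak n N v t p" for p
    using reach_iff_le_peak[of v "v p" n N t p, OF v0] v0 by (cases "p = 0") auto
  then show ?thesis by blast
qed

lemma occurs_chain_full:
  assumes v: "\<And>p. v p \<le> p - 1"
  shows "occurs (seq_matching n v) (Suc t) (chain_matching (Suc t)) l (2 * n + 1) \<longleftrightarrow>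
    (\<exists>p\<in>{1..n}. l \<le> opn n v p \<and> reach n v (\<lambda>q. q \<le> n) t (v p) p)"
proof -
  have "reach n v (\<lambda>q. cls n v q < 2 * n + 1) t x p \<longleftrightarrow> reach n v (\<lambda>q. q \<le> n) t x p"
    if "p \<in> {1..n}" for x p
    using reach_mono[of n "\<lambda>q. cls n v q < 2 * n + 1" "\<lambda>q. q \<le> n" p v t x]
      reach_mono[of n "\<lambda>q. q \<le> n" "\<lambda>q. cls n v q < 2 * n + 1" p v t x]
      opn_le_length(2)[of v _ n, OF v] that by auto
  then show ?thesis unfolding occurs_chain[OF v] by blast
qed

text \<open>A closer lies left of some opener iff its index is at most the largest value of \<open>v\<close>.\<close>

lemma occurs_chain_arc:
  assumes v: "\<And>p. v p \<le> p - 1" and l: "l \<le> 2 * n + 1"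
  shows "(\<exists>x. l \<le> x \<and> x \<le> 2 * n + 1 \<and>
      occurs (seq_matching n v) (Suc t) (chain_matching (Suc t)) l x \<and>
      occurs (seq_matching n v) 1 single_arc x (2 * n + 1)) \<longleftrightarrow>
    (\<exists>p\<in>{1..n}. l \<le> opn n v p \<and> reach n v (\<lambda>q. q \<le> Max (v ` {..n})) t (v p) p)"
    (is "?L \<longleftrightarrow> ?R")
proof
  assume ?L
  then obtain x p q where p: "p \<in> {1..n}" "l \<le> opn n v p" "reach n v (\<lambda>q. cls n v q < x) t (v p) p"
    and q: "q \<in> {1..n}" "x \<le> opn n v q"
    unfolding occurs_chain[OF v] occurs_single_arc[OF v] by blast
  have "r \<le> Max (v ` {..n})" if "cls n v r < x" for r
  proof -
    have "r \<le> v q" using cls_less_opn_iff[OF q(1), of v r] that q(2) by simp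
    also have "\<dots> \<le> Max (v ` {..n})" using q(1) by (intro Max_ge) auto
    finally show ?thesis .
  qed
  then have "reach n v (\<lambda>q. q \<le> Max (v ` {..n})) t (v p) p"
    using reach_mono[of n "\<lambda>q. cls n v q < x" "\<lambda>q. q \<le> Max (v ` {..n})"] p by blast
  then show ?R using p by blast
next
  assume ?R
  then obtain p where p: "p \<in> {1..n}" "l \<le> opn n v p"
    and r: "reach n v (\<lambda>q. q \<le> Max (v ` {..n})) t (v p) p" by blast
  obtain q where q: "q \<le> n" "v q = Max (v ` {..n})" by (rule Max_attained)
  obtain r where r': "r \<in> {1..n}" "r \<le> Max (v ` {..n})" using reach_end[OF p(1) r] by blast
  \<comment> \<open>The largest value is positive because the last closer of the chain has index at
    least \<open>1\<close>; hence it is attained at a genuine arc.\<close>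
  have "q \<noteq> 0" using r' q(2)[symmetric] v[of 0] by (cases "q = 0") auto
  then have qn: "q \<in> {1..n}" using q by simp
  have "cls n v r < opn n v q" if "r \<le> Max (v ` {..n})" for r
    using cls_less_opn[OF qn, of r v] that q(2) by simp
  then have r2: "reach n v (\<lambda>r. cls n v r < opn n v q) t (v p) p"
    using reach_mono[OF _ p(1) r, of "\<lambda>r. cls n v r < opn n v q"] by blast
  \<comment> \<open>The cut before the final arc is \<open>opn n v q\<close>. Comparing
    \<open>p\<close> with the last closer \<open>e\<close> of the chain shows that this cut is not
    left of \<open>l\<close>.\<close>
  obtain e where "cls n v e < opn n v q" "p \<le> e" using reach_end[OF p(1) r2] by blast
  then have "cls n v p < opn n v q" using cls_less_cls_iff[of n v e p] by linarith
  then have "l \<le> opn n v q" using p opn_le_length(1)[of v p n, OF v] by simp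
  moreover have "opn n v q \<le> 2 * n + 1" "cls n v q < 2 * n + 1"
    using opn_le_length[of v q n, OF v qn] by auto
  ultimately show ?L unfolding occurs_chain[OF v] occurs_single_arc[OF v] using p r2 qn by blast
qed

lemma card_avoiders:
  assumes P: "is_matching m P"
    and contains: "\<And>v. (\<And>p. v p \<le> p - 1) \<Longrightarrow>
      occurs (seq_matching n v) m P 0 (2 * n + 1) \<longleftrightarrow> \<not> Q v"
  shows "card (avoiders n P) = card {v \<in> fishburn_seqs n. Q v}"
proof -
  have "contains_pattern (seq_matching n v) P \<longleftrightarrow> \<not> Q v" if "v \<in> fishburn_seqs n" for v
    using contains_pattern_iff_occurs[OF seq_matching_is_matching P] contains fishburn_seqsD(1)[OF that]
    by blast
  then have "avoiders n P = seq_matching n ` {v \<in> fishburn_seqs n. Q v}"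
    unfolding avoiders_def bij_betw_imp_surj_on[OF bij_betw_seq_matching, symmetric] by blast
  moreover have "inj_on (seq_matching n) {v \<in> fishburn_seqs n. Q v}"
    by (rule inj_on_subset[OF inj_on_seq_matching]) blast
  ultimately show ?thesis by (simp add: card_image)
qed

text \<open>A chain of \<open>t + 2\<close> arcs belongs to level \<open>t\<close>: its last
  \<open>t + 1\<close> arcs are measured by the peak, and its first arc turns into the strict
  inequality.\<close>

lemma card_avoiders_chain:
  "card (avoiders n (chain_matching (t + 2))) = card (high_seqs n (\<lambda>_. n) t)"
  unfolding high_seqs_def
proof (rule card_avoiders[OF is_matching_chain])
  fix v :: "nat \<Rightarrow> nat" assume v: "\<And>p. v p \<le> p - 1"
  show "occurs (seq_matching n v) (t + 2) (chain_matching (t + 2)) 0 (2 * n + 1) \<longleftrightarrow>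
      \<not> (\<forall>p\<le>n. peak n n v t p \<le> v p)"
    using occurs_chain_full[OF v, of n "Suc t" 0] reach_peak_high[OF v, of n n t]
    by (simp add: not_le del: reach.simps)
qed

text \<open>The best candidate for an arc left of the chain is the one with the first closer, and
  that closer precedes the opener of \<open>p\<close> exactly when
  \<open>1 \<le> v p\<close>.\<close>

lemma arc_before_reach:
  assumes v: "\<And>p. v p \<le> p - 1"
  shows "(\<exists>x\<le>2 * n + 1. (\<exists>q\<in>{1..n}. cls n v q < x) \<and>
      (\<exists>p\<in>{1..n}. x \<le> opn n v p \<and> reach n v (\<lambda>q. q \<le> N) t (v p) p)) \<longleftrightarrow>
    (\<exists>p\<in>{1..n}. 1 \<le> v p \<and> reach n v (\<lambda>q. q \<le> N) t (v p) p)"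
proof (intro iffI; elim exE conjE bexE)
  fix x q p
  assume "q \<in> {1..n}" "cls n v q < x" and p: "p \<in> {1..n}" "x \<le> opn n v p"
    and r: "reach n v (\<lambda>q. q \<le> N) t (v p) p"
  then have "q \<le> v p" using cls_less_opn_iff[of p n v q] by simp
  then have "1 \<le> v p" using \<open>q \<in> {1..n}\<close> by simp
  then show "\<exists>p\<in>{1..n}. 1 \<le> v p \<and> reach n v (\<lambda>q. q \<le> N) t (v p) p" using p r by blast
next
  fix p assume p: "p \<in> {1..n}" and p1: "1 \<le> v p" and r: "reach n v (\<lambda>q. q \<le> N) t (v p) p"
  have "opn n v p \<le> 2 * n + 1" using opn_le_length[of v p n, OF v p] by simp
  moreover have "cls n v 1 < opn n v p" "1 \<in> {1..n}" using cls_less_opn[of p n 1 v, OF p p1] p by auto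
  ultimately show "\<exists>x\<le>2 * n + 1. (\<exists>q\<in>{1..n}. cls n v q < x) \<and>
      (\<exists>p\<in>{1..n}. x \<le> opn n v p \<and> reach n v (\<lambda>q. q \<le> N) t (v p) p)" using p r by blast
qed

lemma card_avoiders_arc_chain:
  "card (avoiders n (msum single_arc (chain_matching (t + 1)))) = card (low_seqs n (\<lambda>_. n) t)"
  unfolding low_seqs_def
proof (rule card_avoiders[OF is_matching_msum[OF is_matching_single_arc is_matching_chain]])
  fix v :: "nat \<Rightarrow> nat" assume v: "\<And>p. v p \<le> p - 1"
  have "occurs (seq_matching n v) (1 + (t + 1)) (msum single_arc (chain_matching (t + 1))) 0 (2 * n + 1)
    \<longleftrightarrow> (\<exists>x\<le>2 * n + 1. (\<exists>q\<in>{1..n}. cls n v q < x) \<and>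
        (\<exists>p\<in>{1..n}. x \<le> opn n v p \<and> reach n v (\<lambda>q. q \<le> n) t (v p) p))"
    unfolding occurs_msum[OF is_matching_single_arc is_matching_chain zero_le] occurs_single_arc[OF v]
    using occurs_chain_full[OF v, of n t] by simp
  also have "\<dots> \<longleftrightarrow> \<not> (\<forall>p\<le>n. v p = 0 \<or> peak n n v t p < v p)"
    unfolding arc_before_reach[OF v] reach_peak_low[OF v] by (auto simp: not_less)
  finally show "occurs (seq_matching n v) (1 + (t + 1)) (msum single_arc (chain_matching (t + 1))) 0 (2 * n + 1)
    \<longleftrightarrow> \<not> (\<forall>p\<le>n. v p = 0 \<or> peak n n v t p < v p)" .
qed

lemma card_avoiders_chain_arc:
  "card (avoiders n (msum (chain_matching (t + 2)) single_arc)) =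
    card (high_seqs n (\<lambda>v. Max (v ` {..n})) t)"
  unfolding high_seqs_def
proof (rule card_avoiders[OF is_matching_msum[OF is_matching_chain is_matching_single_arc]])
  fix v :: "nat \<Rightarrow> nat" assume v: "\<And>p. v p \<le> p - 1"
  show "occurs (seq_matching n v) (t + 2 + 1) (msum (chain_matching (t + 2)) single_arc) 0 (2 * n + 1)
    \<longleftrightarrow> \<not> (\<forall>p\<le>n. peak n (Max (v ` {..n})) v t p \<le> v p)"
    unfolding occurs_msum[OF is_matching_chain is_matching_single_arc zero_le]
    using occurs_chain_arc[OF v, of 0 n "Suc t"] reach_peak_high[OF v, of n "Max (v ` {..n})" t]
    by (simp add: not_le del: reach.simps)
qed

lemma card_avoiders_arc_chain_arc:
  "card (avoiders n (msum (msum single_arc (chain_matching (t + 1))) single_arc)) =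
    card (low_seqs n (\<lambda>v. Max (v ` {..n})) t)"
  unfolding low_seqs_def
proof (rule card_avoiders[OF is_matching_msum[OF is_matching_msum[OF is_matching_single_arc is_matching_chain]
        is_matching_single_arc]])
  fix v :: "nat \<Rightarrow> nat" assume v: "\<And>p. v p \<le> p - 1"
  let ?M = "seq_matching n v" and ?C = "chain_matching (t + 1)" and ?h = "2 * n + 1"
  let ?N = "Max (v ` {..n})"
  have "occurs ?M (1 + (t + 1) + 1) (msum (msum single_arc ?C) single_arc) 0 ?h \<longleftrightarrow>
      (\<exists>x\<le>?h. (\<exists>y\<le>x. occurs ?M 1 single_arc 0 y \<and> occurs ?M (t + 1) ?C y x) \<and>
        occurs ?M 1 single_arc x ?h)"
    unfolding occurs_msum[OF is_matching_msum[OF is_matching_single_arc is_matching_chain]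
        is_matching_single_arc zero_le]
      occurs_msum[OF is_matching_single_arc is_matching_chain zero_le] by simp
  \<comment> \<open>Choosing the left cut first makes the rest a chain followed by an arc in the
    window starting at \<open>y\<close>, the form of \<open>occurs_chain_arc\<close>.\<close>
  also have "\<dots> \<longleftrightarrow> (\<exists>y\<le>?h. occurs ?M 1 single_arc 0 y \<and>
      (\<exists>x. y \<le> x \<and> x \<le> ?h \<and> occurs ?M (Suc t) (chain_matching (Suc t)) y x \<and>
        occurs ?M 1 single_arc x ?h))"
    by (auto intro: le_trans)
  also have "\<dots> \<longleftrightarrow> (\<exists>y\<le>?h. (\<exists>q\<in>{1..n}. cls n v q < y) \<and>
        (\<exists>p\<in>{1..n}. y \<le> opn n v p \<and> reach n v (\<lambda>q. q \<le> ?N) t (v p) p))"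
  proof -
    have "(\<exists>x. y \<le> x \<and> x \<le> ?h \<and> occurs ?M (Suc t) (chain_matching (Suc t)) y x \<and>
        occurs ?M 1 single_arc x ?h) \<longleftrightarrow>
      (\<exists>p\<in>{1..n}. y \<le> opn n v p \<and> reach n v (\<lambda>q. q \<le> ?N) t (v p) p)" if "y \<le> ?h" for y
      by (rule occurs_chain_arc[OF v that])
    moreover have "occurs ?M 1 single_arc 0 y \<longleftrightarrow> (\<exists>q\<in>{1..n}. cls n v q < y)" for y
      unfolding occurs_single_arc[OF v] by simp
    ultimately show ?thesis by (intro ex_cong1 conj_cong refl)
  qed
  also have "\<dots> \<longleftrightarrow> \<not> (\<forall>p\<le>n. v p = 0 \<or> peak n ?N v t p < v p)"
    unfolding arc_before_reach[OF v] reach_peak_low[OF v] by (auto simp: not_less)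
  finally show "occurs ?M (1 + (t + 1) + 1) (msum (msum single_arc ?C) single_arc) 0 ?h \<longleftrightarrow>
    \<not> (\<forall>p\<le>n. v p = 0 \<or> peak n ?N v t p < v p)" .
qed

section \<open>Reversal\<close>

definition reverse :: "nat \<Rightarrow> nat set set \<Rightarrow> nat set set" where
  "reverse n M = (\<lambda>B. (\<lambda>x. 2 * n + 1 - x) ` B) ` M"

lemma reverse_reverse:
  assumes "is_matching n M"
  shows "reverse n (reverse n M) = M"
proof -
  have "(\<lambda>x. 2 * n + 1 - x) ` (\<lambda>x. 2 * n + 1 - x) ` B = B" if "B \<in> M" for B
  proof -
    have "B \<subseteq> {1..2 * n}" by (rule is_matchingD(2)[OF assms that])
    then have "2 * n + 1 - (2 * n + 1 - x) = x" if "x \<in> B" for x using that by fastforce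
    then show ?thesis unfolding image_image by simp
  qed
  then show ?thesis unfolding reverse_def image_image[of _ _ M] by simp
qed

lemma is_matching_reverse:
  assumes M: "is_matching n M"
  shows "is_matching n (reverse n M)"
proof (rule is_matchingI)
  note D = is_matchingD[OF M]
  let ?f = "\<lambda>x. 2 * n + 1 - x"
  have inj: "inj_on ?f {1..2 * n}" by (rule inj_onI) auto
  have "\<Union>(reverse n M) = ?f ` {1..2 * n}" unfolding D(1)[symmetric] reverse_def by blast
  also have "\<dots> = {1..2 * n}"
  proof (intro equalityI subsetI)
    fix x assume "x \<in> {1..2 * n}"
    then show "x \<in> ?f ` {1..2 * n}" by (intro image_eqI[of _ _ "2 * n + 1 - x"]) auto
  qed auto
  finally show "\<Union>(reverse n M) = {1..2 * n}" .
  show "card B = 2" if "B \<in> reverse n M" for B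
    using that D(3) card_image[OF inj_on_subset[OF inj D(2)]] by (auto simp: reverse_def)
  show "B \<inter> B' = {}" if BB: "B \<in> reverse n M" "B' \<in> reverse n M" "B \<noteq> B'" for B B'
  proof -
    obtain C C' where C: "C \<in> M" "C' \<in> M" "B = ?f ` C" "B' = ?f ` C'"
      using BB unfolding reverse_def by blast
    then have "C \<inter> C' = {}" using D(4)[of C C'] BB(3) by blast
    then show ?thesis using inj_on_image_Int[OF inj D(2)[OF C(1)] D(2)[OF C(2)]] C by simp
  qed
qed

lemma reverse_arc:
  assumes M: "is_matching n M" and x: "{x, y} \<in> reverse n M"
  shows "{2 * n + 1 - x, 2 * n + 1 - y} \<in> M" "x \<in> {1..2 * n}" "y \<in> {1..2 * n}"
proof -
  have "(\<lambda>x. 2 * n + 1 - x) ` {x, y} \<in> reverse n (reverse n M)" using x unfolding reverse_def by blast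
  then show "{2 * n + 1 - x, 2 * n + 1 - y} \<in> M" unfolding reverse_reverse[OF M] by simp
  show "x \<in> {1..2 * n}" "y \<in> {1..2 * n}" using is_matchingD(2)[OF is_matching_reverse[OF M] x] by auto
qed

text \<open>Mirroring turns openers into closers and reverses nesting neighbours, so it interchanges
  types I and II.\<close>

lemma reverse_stoimenow:
  assumes "M \<in> stoimenow_matchings n"
  shows "reverse n M \<in> stoimenow_matchings n"
proof -
  have M: "is_matching n M" and nI: "\<not> type_I M" and nII: "\<not> type_II M"
    using assms by (auto simp: stoimenow_matchings_def)
  note A = reverse_arc[OF M]
  have "\<not> type_I (reverse n M)"
  proof
    assume "type_I (reverse n M)"
    then obtain i k l where *: "{i, l} \<in> reverse n M" "{i + 1, k} \<in> reverse n M" "i + 1 < k" "k < l"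
      unfolding type_I_def by blast
    \<comment> \<open>The adjacent openers \<open>i\<close> and \<open>i + 1\<close> are mirrored to
      the adjacent closers \<open>j + 1\<close> and \<open>j\<close>.\<close>
    define j where "j = 2 * n - i"
    have "j + 1 = 2 * n + 1 - i" "j = 2 * n + 1 - (i + 1)" using A(2)[OF *(1)] by (auto simp: j_def)
    then have "{2 * n + 1 - l, j + 1} \<in> M" "{2 * n + 1 - k, j} \<in> M"
      using A(1)[OF *(1)] A(1)[OF *(2)] by (simp_all add: insert_commute)
    moreover have "2 * n + 1 - l < 2 * n + 1 - k" "2 * n + 1 - k < j"
      using * A(3)[OF *(1)] by (auto simp: j_def)
    ultimately show False using nII unfolding type_II_def by blast
  qed
  moreover have "\<not> type_II (reverse n M)"
  proof
    assume "type_II (reverse n M)"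
    then obtain j k l where *: "{k, j + 1} \<in> reverse n M" "{l, j} \<in> reverse n M" "k < l" "l < j"
      unfolding type_II_def by blast
    define i where "i = 2 * n - j"
    have "i = 2 * n + 1 - (j + 1)" "i + 1 = 2 * n + 1 - j"
      using A(3)[OF *(1)] by (auto simp: i_def)
    then have "{i, 2 * n + 1 - k} \<in> M" "{i + 1, 2 * n + 1 - l} \<in> M"
      using A(1)[OF *(1)] A(1)[OF *(2)] by (simp_all add: insert_commute)
    moreover have "i + 1 < 2 * n + 1 - l" "2 * n + 1 - l < 2 * n + 1 - k"
      using * A(3)[OF *(1)] A(2)[OF *(1)] by (auto simp: i_def)
    ultimately show False using nI unfolding type_I_def by blast
  qed
  ultimately show ?thesis using is_matching_reverse[OF M] by (simp add: stoimenow_matchings_def)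
qed

lemma contains_pattern_reverse:
  assumes M: "is_matching n M" and P: "is_matching m P" and c: "contains_pattern M P"
  shows "contains_pattern (reverse n M) (reverse m P)"
proof -
  obtain s where s: "strict_mono_on {1..2 * m} s" "\<And>B. B \<in> P \<Longrightarrow> s ` B \<in> M"
    "\<And>x. x \<in> {1..2 * m} \<Longrightarrow> s x < 2 * n + 1"
    using c unfolding contains_pattern_iff_occurs[OF M P] occurs_def by blast
  define s' where "s' x = 2 * n + 1 - s (2 * m + 1 - x)" for x
  have "occurs (reverse n M) m (reverse m P) 0 (2 * n + 1)" unfolding occurs_def
  proof (intro exI conjI ballI)
    show "strict_mono_on {1..2 * m} s'"
    proof (rule strict_mono_onI)
      fix x y assume "x \<in> {1..2 * m}" "y \<in> {1..2 * m}" "x < y"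
      then have "2 * m + 1 - x \<in> {1..2 * m}" "2 * m + 1 - y \<in> {1..2 * m}"
        "2 * m + 1 - y < 2 * m + 1 - x" by auto
      then have "s (2 * m + 1 - y) < s (2 * m + 1 - x)" "s (2 * m + 1 - x) < 2 * n + 1"
        using strict_mono_onD[OF s(1), of "2 * m + 1 - y" "2 * m + 1 - x"] s(3)[of "2 * m + 1 - x"]
        by blast+
      then show "s' x < s' y" by (simp add: s'_def)
    qed
    show "s' ` B \<in> reverse n M" if B: "B \<in> reverse m P" for B
    proof -
      obtain C where C: "C \<in> P" "B = (\<lambda>x. 2 * m + 1 - x) ` C" using B unfolding reverse_def by blast
      have "C \<subseteq> {1..2 * m}" by (rule is_matchingD(2)[OF P C(1)])
      then have "s' (2 * m + 1 - x) = 2 * n + 1 - s x" if "x \<in> C" for x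
        using that by (fastforce simp: s'_def)
      then have "s' ` B = (\<lambda>x. 2 * n + 1 - x) ` s ` C" unfolding C(2) image_image by simp
      then show ?thesis using s(2)[OF C(1)] unfolding reverse_def by blast
    qed
    fix x assume x: "x \<in> {1..2 * m}"
    \<comment> \<open>A position \<open>0\<close> would be mirrored to \<open>2 * n + 1\<close>,
      outside the window. It is excluded because every pattern position lies in a block, which
      \<open>s\<close> maps onto a block of \<open>M\<close>.\<close>
    then have "1 \<le> s (2 * m + 1 - x)"
    proof -
      have "2 * m + 1 - x \<in> \<Union>P" unfolding is_matchingD(1)[OF P] using x by auto
      then obtain B where "B \<in> P" "2 * m + 1 - x \<in> B" by blast
      then show ?thesis using is_matchingD(2)[OF M s(2)] by fastforce
    qed
    then show "s' x < 2 * n + 1" by (simp add: s'_def)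
  qed simp
  then show ?thesis
    by (simp only: contains_pattern_iff_occurs[OF is_matching_reverse[OF M] is_matching_reverse[OF P]])
qed

lemma card_avoiders_reverse:
  assumes P: "is_matching m P"
  shows "card (avoiders n (reverse m P)) = card (avoiders n P)"
proof (rule bij_betw_same_card[OF bij_betwI])
  have S: "is_matching n M" if "M \<in> stoimenow_matchings n" for M
    using that by (simp add: stoimenow_matchings_def)
  show "reverse n \<in> avoiders n (reverse m P) \<rightarrow> avoiders n P"
    using contains_pattern_reverse[OF is_matching_reverse P] reverse_stoimenow S
    unfolding avoiders_def by (fastforce simp: reverse_reverse)
  show "reverse n \<in> avoiders n P \<rightarrow> avoiders n (reverse m P)"
    using contains_pattern_reverse[OF is_matching_reverse is_matching_reverse[OF P]] reverse_stoimenow S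
    unfolding avoiders_def by (fastforce simp: reverse_reverse P)
  show "reverse n (reverse n M) = M" if "M \<in> avoiders n (reverse m P)" for M
    using that S reverse_reverse by (simp add: avoiders_def)
  show "reverse n (reverse n M) = M" if "M \<in> avoiders n P" for M
    using that S reverse_reverse by (simp add: avoiders_def)
qed

lemma reverse_msum:
  assumes P: "is_matching p P" and Q: "is_matching q Q"
  shows "reverse (p + q) (msum P Q) = msum (reverse q Q) (reverse p P)"
proof -
  have 1: "(\<lambda>x. 2 * (p + q) + 1 - x) ` B = (\<lambda>x. x + 2 * q) ` (\<lambda>x. 2 * p + 1 - x) ` B" if "B \<in> P" for B
    unfolding image_image using is_matchingD(2)[OF P that] by (intro image_cong) auto
  have 2: "(\<lambda>x. 2 * (p + q) + 1 - x) ` (\<lambda>x. x + 2 * p) ` B = (\<lambda>x. 2 * q + 1 - x) ` B" for B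
    unfolding image_image by (intro image_cong) auto
  have "reverse (p + q) (msum P Q) = (\<lambda>B. (\<lambda>x. x + 2 * q) ` (\<lambda>x. 2 * p + 1 - x) ` B) ` P \<union> reverse q Q"
    unfolding reverse_def msum_def is_matching_card[OF P] image_Un image_image[of _ _ Q]
    using 1 2 by simp
  then show ?thesis
    unfolding msum_def is_matching_card[OF is_matching_reverse[OF Q]] reverse_def[of p] image_image[of _ _ P]
    by blast
qed

lemma reverse_single_arc: "reverse 1 single_arc = single_arc"
  by (simp add: reverse_def single_arc_def insert_commute)

text \<open>The defining inequalities of a chain are symmetric; the mirror image of arc
  \<open>i\<close> is arc \<open>m + 1 - i\<close>.\<close>

lemma reverse_chain: "reverse m (chain_matching m) = chain_matching m"
proof -
  define F where "F i = {chain_opener i, chain_closer m i}" for i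
  have chain: "chain_matching m = F ` {1..m}" unfolding chain_matching_eq F_def by auto
  have F: "(\<lambda>x. 2 * m + 1 - x) ` F i = F (m + 1 - i)" if "i \<in> {1..m}" for i
    using that by (auto simp: F_def chain_opener_def chain_closer_def)
  have flip: "(\<lambda>i. m + 1 - i) ` {1..m} = {1..m}"
  proof (intro equalityI subsetI)
    fix i assume "i \<in> {1..m}"
    then show "i \<in> (\<lambda>i. m + 1 - i) ` {1..m}" by (intro image_eqI[of _ _ "m + 1 - i"]) auto
  qed auto
  have "reverse m (chain_matching m) = (\<lambda>i. F (m + 1 - i)) ` {1..m}"
    unfolding reverse_def chain image_image by (intro image_cong refl) (rule F)
  also have "\<dots> = F ` (\<lambda>i. m + 1 - i) ` {1..m}" by (simp only: image_image)
  finally show ?thesis unfolding flip chain .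
qed

section \<open>Combining the equalities\<close>

lemma card_avoiders_P4_P5:
  assumes "k \<ge> 1"
  shows "card (avoiders n (P4 k)) = card (avoiders n (P5 k))"
proof -
  have "P5 k = reverse k (P4 k)"
    using reverse_msum[OF is_matching_single_arc is_matching_chain, of "k - 1"] assms
    by (simp add: P4_def P5_def reverse_single_arc[unfolded One_nat_def] reverse_chain)
  moreover have "is_matching k (P4 k)"
    using is_matching_msum[OF is_matching_single_arc is_matching_chain, of "k - 1"] assms
    by (simp add: P4_def)
  ultimately show ?thesis using card_avoiders_reverse by simp
qed

lemma msum_empty: "msum M {} = M" "msum {} M = M"
  by (auto simp: msum_def)

theorem theorem1p2:
  fixes k n :: nat
  assumes "k \<ge> 1"
  shows "card (avoiders n (P2 k)) = card (avoiders n (P3 k)) \<and>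
         card (avoiders n (P3 k)) = card (avoiders n (P4 k)) \<and>
         card (avoiders n (P4 k)) = card (avoiders n (P5 k))"
proof -
  have P45: "card (avoiders n (P4 k)) = card (avoiders n (P5 k))"
    by (rule card_avoiders_P4_P5[OF assms])
  have P24: "card (avoiders n (P2 (t + 2))) = card (avoiders n (P4 (t + 2)))" for t
    using card_avoiders_chain[of n t] card_avoiders_arc_chain[of n t] card_low_high[of "\<lambda>_. n" n t]
    by (simp add: P2_def P4_def)
  \<comment> \<open>The level comparison of \<open>P3\<close> and \<open>P5\<close> needs a nonempty
    chain between the outer arcs of \<open>P3\<close>, that is \<open>k \<ge> 3\<close>. For
    \<open>k = 2\<close> that chain is empty and \<open>P3\<close> coincides with \<open>P4\<close>;
    for \<open>k = 1\<close> all patterns are a single arc.\<close>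
  consider "k = 1" | "k = 2" | t where "k = t + 3"
  proof -
    have "k = 1 \<or> k = 2 \<or> k = (k - 3) + 3" using assms by linarith
    then show thesis using that by blast
  qed
  then show ?thesis
  proof cases
    case 1
    then show ?thesis using chain_1 by (simp add: P2_def P3_def P4_def P5_def chain_0 msum_empty)
  next
    case 2
    then have "P3 k = P4 k" using chain_1 by (simp add: P3_def P4_def chain_0 msum_empty)
    then show ?thesis using P24[of 0] P45 2 by (simp add: numeral_2_eq_2)
  next
    case (3 t)
    \<comment> \<open>The inner chain of \<open>P3\<close> has \<open>t + 1\<close> arcs and that of
      \<open>P5\<close> has \<open>t + 2\<close>, so both patterns belong to level
      \<open>t\<close>.\<close>
    have "card (avoiders n (P3 k)) = card (avoiders n (P5 k))"
      using card_avoiders_chain_arc[of n t] card_avoiders_arc_chain_arc[of n t]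
        card_low_high[of "\<lambda>v. Max (v ` {..n})" n t] 3
      by (simp add: P3_def P5_def)
    then show ?thesis using P24[of "t + 1"] P45 3 by (simp add: eval_nat_numeral)
  qed
qed

end
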